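(* Let $\alpha\in\widehat{\Gamma}$ be a character of $\Gamma$. Then the character-automorphic Hardy space $\mathcal{H}_2^\alpha(\mathbb{D})$ can be described as $$\mathcal{H}_2^\alpha(\mathbb{D})=\left\{F(z)=\frac{\sqrt{2}\,A^\alpha(z)}{1-i\mathfrak{z}(z)}\,f(\sigma(z))\ :\ f\in\mathcal{H}(\mathscr{S}_\alpha)\right\},$$ with the norm $$\|F\|_{\mathcal{H}_2^\alpha(\mathbb{D})}=\|f\|_{\mathcal{H}(\mathscr{S}_\alpha)} .$$ Here the formula for $F$ is understood literally for $z\in\Omega_+$ (where $\sigma(z)\in\mathbb{D}$) and by analytic extension on all of $\mathbb{D}$; that is, for each $f\in\mathcal{H}(\mathscr{S}_\alpha)$ the function given by the formula on $\Omega_+$ has a (unique) analytic extension $F$ to $\mathbb{D}$, and $\mathcal{H}_2^\alpha(\mathbb{D})$ is exactly the set of these extensions.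
   Context: Setting. $\mathbb{D}$ is the open unit disk, and $w^*$ denotes the complex conjugate of a number $w$. $\Gamma$ is a Fuchsian group (a properly discontinuous group of Möbius transformations, each mapping $\mathbb{D}$, the unit circle $\mathbb{T}$ and $\mathbb{C}\setminus\overline{\mathbb{D}}$ onto themselves), of convergence type ($\sum_{\gamma\in\Gamma}(1-|\gamma(z)|^2)<\infty$ for $z\in\mathbb{D}$), without elliptic and parabolic elements, and of Widom type. $\widehat{\Gamma}$ is the group of unimodular characters of $\Gamma$. The Green's function of $\Gamma$ with respect to $0$ is the Blaschke product $$b(z)=b_0(z)=\prod_{\gamma\in\Gamma}\frac{\gamma(0)-z}{1-\overline{\gamma(0)}z}\,\frac{|\gamma(0)|}{\gamma(0)}$$ (with the usual convention for Blaschke products that a factor with $\gamma(0)=0$ is $z$). Widom type means that $b'$ is of bounded characteristic. $\mu\in\widehat{\Gamma}$ is the character of $b$: $b\circ\gamma=\mu(\gamma)b$ for all $\gamma\in\Gamma$. Hardy spaces. For $\alpha\in\widehat{\Gamma}$, $\mathcal{H}_2^\alpha(\mathbb{D})=\{f\in\mathcal{H}_2(\mathbb{D}) : f\circ\gamma=\alpha(\gamma)f\ \ \forall\gamma\in\Gamma\}$, with the norm of the classical Hardy space $\mathcal{H}_2(\mathbb{D})$. It has a reproducing kernel $k^\alpha(z,\omega)$, and $k^\alpha(\xi,\xi)>0$ for all $\xi\in\mathbb{D}$. Covering map. $E$ is a set associated to $\Gamma$ such that $\overline{\mathbb{C}}\setminus E$ is equivalent to the Riemann surface $\mathbb{D}/\Gamma$,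 and $\mathfrak{z}:\mathbb{D}\to\overline{\mathbb{C}}\setminus E$ is a universal covering map with $\mathfrak{z}\circ\gamma=\mathfrak{z}$ for all $\gamma\in\Gamma$, with $\mathfrak{z}(z_1)=\mathfrak{z}(z_2)$ implying $z_1=\gamma(z_2)$ for some $\gamma\in\Gamma$, and normalized so that $(\mathfrak{z}b)(0)$ is real and positive (so $\mathfrak{z}(0)=\infty$). The triple $(\Gamma,E,\mathfrak{z})$ is such that, for every $\alpha\in\widehat{\Gamma}$, the reproducing kernel has the form (a known result, taken as given) $$k^\alpha(z,\omega)=c(\alpha)\,\frac{\frac{k^{\alpha\mu}(z,0)}{b(z)}\,k^\alpha(\omega,0)^*-\left(\frac{k^{\alpha\mu}(\omega,0)}{b(\omega)}\right)^{*}k^\alpha(z,0)}{\mathfrak{z}(z)-\mathfrak{z}(\omega)^*},\qquad c(\alpha)=\frac{(\mathfrak{z}b)(0)}{k^{\alpha\mu}(0,0)}>0 .$$ Notation. $\Omega_+=\{z\in\mathbb{D} : \operatorname{Im}\mathfrak{z}(z)>0\}$, $\ \sigma(z)=\dfrac{1+i\mathfrak{z}(z)}{1-i\mathfrak{z}(z)}$ (so $|\sigma(z)|<1$ for $z\in\Omega_+$), $$A^\alpha(z)=\sqrt{\tfrac{c(\alpha)}{2}}\left(\frac{k^{\alpha\mu}(z,0)}{b(z)}+i\,k^\alpha(z,0)\right),\qquad B^\alpha(z)=\sqrt{\tfrac{c(\alpha)}{2}}\left(\frac{k^{\alpha\mu}(z,0)}{b(z)}-i\,k^\alpha(z,0)\right),$$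 and $S_\alpha(z)=B^\alpha(z)/A^\alpha(z)$. A Schur function is a function analytic and contractive on $\mathbb{D}$. $\mathscr{S}_\alpha$ denotes the unique Schur function such that $S_\alpha(z)=\mathscr{S}_\alpha(\sigma(z))$ for $z\in\Omega_+$ (it exists). $\mathcal{H}(\mathscr{S}_\alpha)$ is the de Branges–Rovnyak space, i.e. the reproducing kernel Hilbert space of functions analytic on $\mathbb{D}$ with reproducing kernel $$K_{\mathscr{S}_\alpha}(\lambda,\nu)=\frac{1-\mathscr{S}_\alpha(\lambda)\mathscr{S}_\alpha(\nu)^*}{1-\lambda\nu^*},\qquad \lambda,\nu\in\mathbb{D}.$$ *)

theory Defs
  imports "HOL-Complex_Analysis.Complex_Analysis" "HOL-Algebra.Bij"
begin

abbreviation unit_disc :: "complex set" where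
  "unit_disc \<equiv> ball 0 1"

abbreviation closed_disc :: "complex set" where
  "closed_disc \<equiv> cball 0 1"


section \<open>Fuchsian groups and their characters\<close>

text \<open>
  A Moebius transformation preserving the disc, the circle and the exterior is represented by its
  restriction to the closed disc. The image of the exterior need not be mentioned, because a
  Moebius transformation is a bijection of the Riemann sphere. Working on the closed disc
  (where no pole occurs) turns composition into the multiplication of \<^const>\<open>BijGroup\<close>, and still
  shows the fixed points on the circle.
\<close>
definition disc_moebius :: "(complex \<Rightarrow> complex) \<Rightarrow> bool" where
  "disc_moebius \<gamma> \<longleftrightarrow>
     (\<exists>a b c d. a * d - b * c \<noteq> 0 \<and> (\<forall>z\<in>closed_disc. c * z + d \<noteq> 0) \<and>
        \<gamma> = restrict (\<lambda>z. (a * z + b) / (c * z + d)) closed_disc) \<and>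
     \<gamma> ` unit_disc = unit_disc \<and> \<gamma> ` sphere 0 1 = sphere 0 1"

definition properly_discontinuous :: "(complex \<Rightarrow> complex) set \<Rightarrow> bool" where
  "properly_discontinuous \<Gamma> \<longleftrightarrow>
     (\<forall>K. compact K \<and> K \<subseteq> unit_disc \<longrightarrow> finite {\<gamma>\<in>\<Gamma>. \<gamma> ` K \<inter> K \<noteq> {}})"

definition fuchsian_group :: "(complex \<Rightarrow> complex) set \<Rightarrow> bool" where
  "fuchsian_group \<Gamma> \<longleftrightarrow>
     subgroup \<Gamma> (BijGroup closed_disc) \<and> (\<forall>\<gamma>\<in>\<Gamma>. disc_moebius \<gamma>) \<and> properly_discontinuous \<Gamma>"

text \<open>
  The fixed points on the sphere of a disc-preserving Moebius transformation are symmetric with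
  respect to the circle. So such a map, if not the identity, is elliptic iff it fixes a point of
  the open disc, and it has exactly one fixed point on the sphere (i.e. it is parabolic) iff it
  has exactly one in the closed disc and this one lies on the circle.
\<close>
definition elliptic :: "(complex \<Rightarrow> complex) \<Rightarrow> bool" where
  "elliptic \<gamma> \<longleftrightarrow> \<gamma> \<noteq> \<one>\<^bsub>BijGroup closed_disc\<^esub> \<and> (\<exists>z\<in>unit_disc. \<gamma> z = z)"

definition parabolic :: "(complex \<Rightarrow> complex) \<Rightarrow> bool" where
  "parabolic \<gamma> \<longleftrightarrow> (\<exists>\<zeta>\<in>sphere 0 1. {z\<in>closed_disc. \<gamma> z = z} = {\<zeta>})"

definition convergence_type :: "(complex \<Rightarrow> complex) set \<Rightarrow> bool" where
  "convergence_type \<Gamma> \<longleftrightarrow> (\<forall>z\<in>unit_disc. (\<lambda>\<gamma>. 1 - (cmod (\<gamma> z))\<^sup>2) summable_on \<Gamma>)"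

text \<open>Only the values of a character on \<open>\<Gamma>\<close> are relevant.\<close>
definition unimodular_character ::
    "(complex \<Rightarrow> complex) set \<Rightarrow> ((complex \<Rightarrow> complex) \<Rightarrow> complex) \<Rightarrow> bool" where
  "unimodular_character \<Gamma> \<alpha> \<longleftrightarrow>
     (\<forall>\<gamma>\<in>\<Gamma>. cmod (\<alpha> \<gamma>) = 1) \<and>
     (\<forall>\<gamma>\<in>\<Gamma>. \<forall>\<delta>\<in>\<Gamma>. \<alpha> (\<gamma> \<otimes>\<^bsub>BijGroup closed_disc\<^esub> \<delta>) = \<alpha> \<gamma> * \<alpha> \<delta>)"


section \<open>The Green's function and Widom type\<close>

definition blaschke_factor :: "complex \<Rightarrow> complex \<Rightarrow> complex" where
  "blaschke_factor a z =
     (if a = 0 then z else (a - z) / (1 - cnj a * z) * (of_real (cmod a) / a))"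

text \<open>The product over \<open>\<Gamma>\<close> is the unordered one, i.e. the limit over finite subsets.\<close>
definition green :: "(complex \<Rightarrow> complex) set \<Rightarrow> complex \<Rightarrow> complex" where
  "green \<Gamma> z = Lim (finite_subsets_at_top \<Gamma>) (\<lambda>F. \<Prod>\<gamma>\<in>F. blaschke_factor (\<gamma> 0) z)"

definition circle_mean :: "(complex \<Rightarrow> 'b::real_normed_vector) \<Rightarrow> real \<Rightarrow> 'b" where
  "circle_mean f r = (1 / (2 * pi)) *\<^sub>R integral {0..2 * pi} (\<lambda>t. f (of_real r * cis t))"

definition bounded_characteristic :: "(complex \<Rightarrow> complex) \<Rightarrow> bool" where
  "bounded_characteristic f \<longleftrightarrow>
     f holomorphic_on unit_disc \<and>
     bdd_above (circle_mean (\<lambda>z. ln (max 1 (cmod (f z)))) ` {0..<1})"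

definition widom_type :: "(complex \<Rightarrow> complex) set \<Rightarrow> bool" where
  "widom_type \<Gamma> \<longleftrightarrow> bounded_characteristic (deriv (green \<Gamma>))"


section \<open>Reproducing kernel Hilbert spaces of functions\<close>

text \<open>
  Elements are total functions of which only the values on \<open>X\<close> matter; accordingly
  definiteness of the inner product is definiteness on \<open>X\<close>.
\<close>

definition has_reproducing_kernel ::
    "'a set \<Rightarrow> ('a \<Rightarrow> complex) set \<Rightarrow> (('a \<Rightarrow> complex) \<Rightarrow> ('a \<Rightarrow> complex) \<Rightarrow> complex) \<Rightarrow>
     ('a \<Rightarrow> 'a \<Rightarrow> complex) \<Rightarrow> bool" where
  "has_reproducing_kernel X V ip K \<longleftrightarrow>
     (\<forall>\<nu>\<in>X. (\<lambda>x. K x \<nu>) \<in> V \<and> (\<forall>f\<in>V. f \<nu> = ip f (\<lambda>x. K x \<nu>)))"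

definition ip_norm ::
    "(('a \<Rightarrow> complex) \<Rightarrow> ('a \<Rightarrow> complex) \<Rightarrow> complex) \<Rightarrow> ('a \<Rightarrow> complex) \<Rightarrow> real" where
  "ip_norm ip f = sqrt (Re (ip f f))"

definition hilbert_function_space ::
    "'a set \<Rightarrow> ('a \<Rightarrow> complex) set \<Rightarrow> (('a \<Rightarrow> complex) \<Rightarrow> ('a \<Rightarrow> complex) \<Rightarrow> complex) \<Rightarrow> bool" where
  "hilbert_function_space X V ip \<longleftrightarrow>
     (\<lambda>x. 0) \<in> V \<and>
     (\<forall>f\<in>V. \<forall>g\<in>V. (\<lambda>x. f x + g x) \<in> V) \<and>
     (\<forall>f\<in>V. \<forall>c. (\<lambda>x. c * f x) \<in> V) \<and>
     (\<forall>f\<in>V. \<forall>g\<in>V. \<forall>h\<in>V. ip (\<lambda>x. f x + g x) h = ip f h + ip g h) \<and>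
     (\<forall>f\<in>V. \<forall>g\<in>V. \<forall>c. ip (\<lambda>x. c * f x) g = c * ip f g) \<and>
     (\<forall>f\<in>V. \<forall>g\<in>V. ip g f = cnj (ip f g)) \<and>
     (\<forall>f\<in>V. 0 \<le> Re (ip f f)) \<and>
     (\<forall>f\<in>V. ip f f = 0 \<longleftrightarrow> (\<forall>x\<in>X. f x = 0)) \<and>
     (\<forall>s. (\<forall>n. s n \<in> V) \<and>
          (\<forall>e>0. \<exists>N::nat. \<forall>m\<ge>N. \<forall>n\<ge>N. ip_norm ip (\<lambda>x. s m x - s n x) < e) \<longrightarrow>
          (\<exists>f\<in>V. (\<lambda>n. ip_norm ip (\<lambda>x. s n x - f x)) \<longlonglongrightarrow> 0))"


section \<open>Hardy spaces\<close>

definition hardy2 :: "(complex \<Rightarrow> complex) set" where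
  "hardy2 = {f. f holomorphic_on unit_disc \<and>
                bdd_above (circle_mean (\<lambda>z. (cmod (f z))\<^sup>2) ` {0..<1})}"

definition hardy2_norm :: "(complex \<Rightarrow> complex) \<Rightarrow> real" where
  "hardy2_norm f = sqrt (SUP r\<in>{0..<1}. circle_mean (\<lambda>z. (cmod (f z))\<^sup>2) r)"

definition hardy2_inner :: "(complex \<Rightarrow> complex) \<Rightarrow> (complex \<Rightarrow> complex) \<Rightarrow> complex" where
  "hardy2_inner f g = Lim (at_left 1) (circle_mean (\<lambda>z. f z * cnj (g z)))"

definition character_hardy2 ::
    "(complex \<Rightarrow> complex) set \<Rightarrow> ((complex \<Rightarrow> complex) \<Rightarrow> complex) \<Rightarrow> (complex \<Rightarrow> complex) set" where
  "character_hardy2 \<Gamma> \<alpha> = {f\<in>hardy2. \<forall>\<gamma>\<in>\<Gamma>. \<forall>z\<in>unit_disc. f (\<gamma> z) = \<alpha> \<gamma> * f z}"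


section \<open>The universal covering map\<close>

text \<open>
  The Riemann sphere is the unit sphere of \<open>\<complex> \<times> \<real>\<close> with the north pole as the point at infinity.
  A map from the disc to the Riemann sphere is a meromorphic function; at its poles, where a
  HOL function has the value \<open>0\<close> by the convention of \<^const>\<open>nicely_meromorphic_on\<close>,
  the sphere-valued map takes the value infinity.
\<close>
definition stereo :: "complex \<Rightarrow> complex \<times> real" where
  "stereo w = (of_real (2 / ((cmod w)\<^sup>2 + 1)) * w, ((cmod w)\<^sup>2 - 1) / ((cmod w)\<^sup>2 + 1))"

definition to_sphere :: "(complex \<Rightarrow> complex) \<Rightarrow> complex \<Rightarrow> complex \<times> real" where
  "to_sphere g z = (if is_pole g z then (0, 1) else stereo (g z))"

text \<open>
  The disc being simply connected, a covering map defined on it is universal.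
\<close>
definition universal_covering_map ::
    "(complex \<Rightarrow> complex) set \<Rightarrow> complex set \<Rightarrow> (complex \<Rightarrow> complex) \<Rightarrow> bool" where
  "universal_covering_map \<Gamma> E \<zz> \<longleftrightarrow>
     \<zz> nicely_meromorphic_on unit_disc \<and>
     covering_space unit_disc (to_sphere \<zz>) (sphere 0 1 - stereo ` E) \<and>
     (\<forall>\<gamma>\<in>\<Gamma>. \<forall>z\<in>unit_disc. to_sphere \<zz> (\<gamma> z) = to_sphere \<zz> z) \<and>
     (\<forall>z\<^sub>1\<in>unit_disc. \<forall>z\<^sub>2\<in>unit_disc.
        to_sphere \<zz> z\<^sub>1 = to_sphere \<zz> z\<^sub>2 \<longrightarrow> (\<exists>\<gamma>\<in>\<Gamma>. z\<^sub>1 = \<gamma> z\<^sub>2))"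

text \<open>\<open>\<zz> b\<close> at \<open>0\<close>, where \<open>\<zz>\<close> has a pole and \<open>b\<close> a zero.\<close>
definition zb0 :: "(complex \<Rightarrow> complex) set \<Rightarrow> (complex \<Rightarrow> complex) \<Rightarrow> complex" where
  "zb0 \<Gamma> \<zz> = remove_sings (\<lambda>z. \<zz> z * green \<Gamma> z) 0"

definition Omega_plus :: "(complex \<Rightarrow> complex) \<Rightarrow> complex set" where
  "Omega_plus \<zz> = {z\<in>unit_disc. \<not> is_pole \<zz> z \<and> Im (\<zz> z) > 0}"

definition cayley_zz :: "(complex \<Rightarrow> complex) \<Rightarrow> complex \<Rightarrow> complex" where
  "cayley_zz \<zz> z = (1 + \<i> * \<zz> z) / (1 - \<i> * \<zz> z)"


section \<open>The functions \<open>A\<close> and \<open>B\<close>\<close>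

text \<open>
  In what follows \<open>k \<beta> z \<omega>\<close> stands for the reproducing kernel of the Hardy space of the
  character \<open>\<beta>\<close>, and \<open>\<mu>\<close> for the character of the Green's function.
\<close>

type_synonym char_kernel =
  "((complex \<Rightarrow> complex) \<Rightarrow> complex) \<Rightarrow> complex \<Rightarrow> complex \<Rightarrow> complex"

text \<open>\<open>k\<^sup>\<alpha>\<^sup>\<mu>(z, 0) / b(z)\<close>\<close>
definition kernel_quotient ::
    "(complex \<Rightarrow> complex) set \<Rightarrow> char_kernel \<Rightarrow> ((complex \<Rightarrow> complex) \<Rightarrow> complex) \<Rightarrow>
     ((complex \<Rightarrow> complex) \<Rightarrow> complex) \<Rightarrow> complex \<Rightarrow> complex" where
  "kernel_quotient \<Gamma> k \<mu> \<alpha> z = k (\<lambda>\<gamma>. \<alpha> \<gamma> * \<mu> \<gamma>) z 0 / green \<Gamma> z"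

text \<open>Numerator and denominator are positive reals; \<^const>\<open>Re\<close> only changes the type.\<close>
definition c_const ::
    "(complex \<Rightarrow> complex) set \<Rightarrow> (complex \<Rightarrow> complex) \<Rightarrow> char_kernel \<Rightarrow>
     ((complex \<Rightarrow> complex) \<Rightarrow> complex) \<Rightarrow> ((complex \<Rightarrow> complex) \<Rightarrow> complex) \<Rightarrow> real" where
  "c_const \<Gamma> \<zz> k \<mu> \<alpha> = Re (zb0 \<Gamma> \<zz>) / Re (k (\<lambda>\<gamma>. \<alpha> \<gamma> * \<mu> \<gamma>) 0 0)"

definition A_fun ::
    "(complex \<Rightarrow> complex) set \<Rightarrow> (complex \<Rightarrow> complex) \<Rightarrow> char_kernel \<Rightarrow>
     ((complex \<Rightarrow> complex) \<Rightarrow> complex) \<Rightarrow> ((complex \<Rightarrow> complex) \<Rightarrow> complex) \<Rightarrow> complex \<Rightarrow> complex" where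
  "A_fun \<Gamma> \<zz> k \<mu> \<alpha> z =
     of_real (sqrt (c_const \<Gamma> \<zz> k \<mu> \<alpha> / 2)) * (kernel_quotient \<Gamma> k \<mu> \<alpha> z + \<i> * k \<alpha> z 0)"

definition B_fun ::
    "(complex \<Rightarrow> complex) set \<Rightarrow> (complex \<Rightarrow> complex) \<Rightarrow> char_kernel \<Rightarrow>
     ((complex \<Rightarrow> complex) \<Rightarrow> complex) \<Rightarrow> ((complex \<Rightarrow> complex) \<Rightarrow> complex) \<Rightarrow> complex \<Rightarrow> complex" where
  "B_fun \<Gamma> \<zz> k \<mu> \<alpha> z =
     of_real (sqrt (c_const \<Gamma> \<zz> k \<mu> \<alpha> / 2)) * (kernel_quotient \<Gamma> k \<mu> \<alpha> z - \<i> * k \<alpha> z 0)"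

text \<open>
  The explicit form of the kernel \<open>k\<^sup>\<alpha>\<close>, at all points where the quotient makes sense as
  written (elsewhere it is to be read by continuity).
\<close>
definition kernel_formula ::
    "(complex \<Rightarrow> complex) set \<Rightarrow> (complex \<Rightarrow> complex) \<Rightarrow> char_kernel \<Rightarrow>
     ((complex \<Rightarrow> complex) \<Rightarrow> complex) \<Rightarrow> ((complex \<Rightarrow> complex) \<Rightarrow> complex) \<Rightarrow> bool" where
  "kernel_formula \<Gamma> \<zz> k \<mu> \<alpha> \<longleftrightarrow>
     (\<forall>z\<in>unit_disc. \<forall>\<omega>\<in>unit_disc.
        \<not> is_pole \<zz> z \<and> \<not> is_pole \<zz> \<omega> \<and> \<zz> z \<noteq> cnj (\<zz> \<omega>) \<longrightarrow>
        k \<alpha> z \<omega> = of_real (c_const \<Gamma> \<zz> k \<mu> \<alpha>) *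
          ((kernel_quotient \<Gamma> k \<mu> \<alpha> z * cnj (k \<alpha> \<omega> 0) -
            cnj (kernel_quotient \<Gamma> k \<mu> \<alpha> \<omega>) * k \<alpha> z 0) / (\<zz> z - cnj (\<zz> \<omega>))))"


section \<open>de Branges--Rovnyak spaces\<close>

definition schur_function :: "(complex \<Rightarrow> complex) \<Rightarrow> bool" where
  "schur_function S \<longleftrightarrow> S holomorphic_on unit_disc \<and> (\<forall>l\<in>unit_disc. cmod (S l) \<le> 1)"

definition dBR_kernel :: "(complex \<Rightarrow> complex) \<Rightarrow> complex \<Rightarrow> complex \<Rightarrow> complex" where
  "dBR_kernel S l \<nu> = (1 - S l * cnj (S \<nu>)) / (1 - l * cnj \<nu>)"

text \<open>
  \<open>H\<close> with inner product \<open>ip\<close> is the space \<open>\<H>(S)\<close>: the reproducing kernel Hilbert space of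
  analytic functions on the disc with kernel \<^const>\<open>dBR_kernel\<close>. A kernel determines its
  Hilbert space, so \<open>H\<close> (up to values off the disc) and \<open>ip\<close> are unique.
\<close>
definition de_Branges_Rovnyak ::
    "(complex \<Rightarrow> complex) \<Rightarrow> (complex \<Rightarrow> complex) set \<Rightarrow>
     ((complex \<Rightarrow> complex) \<Rightarrow> (complex \<Rightarrow> complex) \<Rightarrow> complex) \<Rightarrow> bool" where
  "de_Branges_Rovnyak S H ip \<longleftrightarrow>
     hilbert_function_space unit_disc H ip \<and>
     has_reproducing_kernel unit_disc H ip (dBR_kernel S) \<and>
     (\<forall>f\<in>H. f holomorphic_on unit_disc)"

text \<open>\<open>F\<close> is an analytic extension to the disc of the function that \<open>f\<close> defines on \<^const>\<open>Omega_plus\<close>.\<close>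
definition extends_transform ::
    "(complex \<Rightarrow> complex) set \<Rightarrow> (complex \<Rightarrow> complex) \<Rightarrow> char_kernel \<Rightarrow>
     ((complex \<Rightarrow> complex) \<Rightarrow> complex) \<Rightarrow> ((complex \<Rightarrow> complex) \<Rightarrow> complex) \<Rightarrow>
     (complex \<Rightarrow> complex) \<Rightarrow> (complex \<Rightarrow> complex) \<Rightarrow> bool" where
  "extends_transform \<Gamma> \<zz> k \<mu> \<alpha> f F \<longleftrightarrow>
     F holomorphic_on unit_disc \<and>
     (\<forall>z\<in>Omega_plus \<zz>.
        F z = of_real (sqrt 2) * A_fun \<Gamma> \<zz> k \<mu> \<alpha> z / (1 - \<i> * \<zz> z) * f (cayley_zz \<zz> z))"

end

theory Submission
  imports Defs
begin

text \<open>
  Write \<open>\<Omega>\<close> for the part of the disc where \<open>Im \<zz> > 0\<close> and \<open>g = \<surd>2 A / (1 - i \<zz>)\<close>. Inserting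
  \<open>A\<close>, \<open>B\<close> and \<open>\<sigma>\<close> into the explicit form of \<open>k\<^sup>\<alpha>\<close> is a computation that gives
  \<open>k\<^sup>\<alpha>(z, w) = g(z) K(\<sigma> z, \<sigma> w) g(w)\<^sup>*\<close> for \<open>z, w \<in> \<Omega>\<close>, where \<open>K\<close> is the kernel of \<open>\<H>(S)\<close>
  (\<open>kernel_factorization\<close>). In other words, the vectors \<open>u\<^sub>y = g(y)\<^sup>* K(\<cdot>, \<sigma> y)\<close> of \<open>\<H>(S)\<close> and
  \<open>v\<^sub>y = k\<^sup>\<alpha>(\<cdot>, y)\<close> of the character-automorphic Hardy space, \<open>y \<in> \<Omega>\<close>, have the same Gram matrix.
  Pairing with them is evaluation: \<open>\<langle>f, u\<^sub>y\<rangle> = g(y) f(\<sigma> y)\<close> and \<open>\<langle>F, v\<^sub>y\<rangle> = F(y)\<close>. Families with equal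
  Gram matrices are matched by an isometry between the closed spans (\<open>equal_gram_isometry\<close>), and
  for the matched pairs these two numbers agree, which is the asserted formula for \<open>F\<close>.

  It remains to see that both closed spans are everything. A vector orthogonal to all \<open>v\<^sub>y\<close> is an
  analytic function that vanishes on \<open>\<Omega>\<close>; one orthogonal to all \<open>u\<^sub>y\<close> vanishes on \<open>\<sigma>(\<Omega>)\<close>, because
  \<open>g\<close> has no zero. Both sets are open, the covering map being locally injective, so the identity
  theorem applies once \<open>\<Omega>\<close> is known to be nonempty (\<open>Omega_plus_nonempty\<close>). That \<open>A\<close>, hence \<open>g\<close>,
  has no zero in \<open>\<Omega>\<close> follows from \<open>k\<^sup>\<alpha>(z, z) > 0\<close> (\<open>A_fun_nonzero\<close>).

  The isometry needs completeness of both spaces. For \<open>\<H>(S)\<close> it is part of the definition; for the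
  Hardy space it is derived from Parseval's identity on circles, which makes the means of \<open>\<bar>f\<bar>\<^sup>2\<close>
  increase with the radius and bounds point evaluations by the norm
  (\<open>hardy2_evaluation_bound\<close>, \<open>character_hardy2_hilbert\<close>).
\<close>

section \<open>Isometries between Hilbert function spaces\<close>

locale hilbert_functions =
  fixes X :: "'a set" and V :: "('a \<Rightarrow> complex) set"
    and ip :: "('a \<Rightarrow> complex) \<Rightarrow> ('a \<Rightarrow> complex) \<Rightarrow> complex"
  assumes hilbert: "hilbert_function_space X V ip"
begin

lemma zero_mem: "(\<lambda>x. 0) \<in> V"
  and add_mem: "f \<in> V \<Longrightarrow> g \<in> V \<Longrightarrow> (\<lambda>x. f x + g x) \<in> V"
  and scale_mem: "f \<in> V \<Longrightarrow> (\<lambda>x. c * f x) \<in> V"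
  and ip_add_left: "f \<in> V \<Longrightarrow> g \<in> V \<Longrightarrow> h \<in> V \<Longrightarrow> ip (\<lambda>x. f x + g x) h = ip f h + ip g h"
  and ip_scale_left: "f \<in> V \<Longrightarrow> g \<in> V \<Longrightarrow> ip (\<lambda>x. c * f x) g = c * ip f g"
  and ip_cnj: "f \<in> V \<Longrightarrow> g \<in> V \<Longrightarrow> ip g f = cnj (ip f g)"
  and ip_self_ge_0: "f \<in> V \<Longrightarrow> 0 \<le> Re (ip f f)"
  and ip_self_eq_0: "f \<in> V \<Longrightarrow> ip f f = 0 \<longleftrightarrow> (\<forall>x\<in>X. f x = 0)"
  using hilbert unfolding hilbert_function_space_def by blast+

lemma complete:
  assumes "\<And>n. s n \<in> V"
    and "\<And>e. e > 0 \<Longrightarrow> \<exists>N::nat. \<forall>m\<ge>N. \<forall>n\<ge>N. ip_norm ip (\<lambda>x. s m x - s n x) < e"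
  obtains f where "f \<in> V" "(\<lambda>n. ip_norm ip (\<lambda>x. s n x - f x)) \<longlonglongrightarrow> 0"
  using hilbert assms unfolding hilbert_function_space_def by blast

lemma diff_mem: "f \<in> V \<Longrightarrow> g \<in> V \<Longrightarrow> (\<lambda>x. f x - g x) \<in> V"
  using add_mem[OF _ scale_mem[of g "-1"], of f] by simp

lemma ip_diff_left:
  "f \<in> V \<Longrightarrow> g \<in> V \<Longrightarrow> h \<in> V \<Longrightarrow> ip (\<lambda>x. f x - g x) h = ip f h - ip g h"
  using ip_add_left[OF _ scale_mem[of g "-1"], of f h] ip_scale_left[of g h "-1"] by simp

lemma ip_add_right:
  "f \<in> V \<Longrightarrow> g \<in> V \<Longrightarrow> h \<in> V \<Longrightarrow> ip h (\<lambda>x. f x + g x) = ip h f + ip h g"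
  using ip_cnj[of "\<lambda>x. f x + g x" h] ip_cnj[of f h] ip_cnj[of g h]
  by (simp add: add_mem ip_add_left)

lemma ip_scale_right:
  "f \<in> V \<Longrightarrow> g \<in> V \<Longrightarrow> ip g (\<lambda>x. c * f x) = cnj c * ip g f"
  using ip_cnj[of "\<lambda>x. c * f x" g] ip_cnj[of f g] by (simp add: scale_mem ip_scale_left)

lemma ip_diff_right:
  "f \<in> V \<Longrightarrow> g \<in> V \<Longrightarrow> h \<in> V \<Longrightarrow> ip h (\<lambda>x. f x - g x) = ip h f - ip h g"
  using ip_cnj[of "\<lambda>x. f x - g x" h] ip_cnj[of f h] ip_cnj[of g h]
  by (simp add: diff_mem ip_diff_left)

lemma ip_zero_left: "h \<in> V \<Longrightarrow> ip (\<lambda>x. 0) h = 0"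
  using ip_scale_left[OF zero_mem, of h 0] by simp

lemma norm_ge_0: "f \<in> V \<Longrightarrow> 0 \<le> ip_norm ip f"
  by (simp add: ip_norm_def ip_self_ge_0)

lemma norm_power2: "f \<in> V \<Longrightarrow> (ip_norm ip f)\<^sup>2 = Re (ip f f)"
  by (simp add: ip_norm_def ip_self_ge_0)

lemma ip_self: "f \<in> V \<Longrightarrow> ip f f = of_real ((ip_norm ip f)\<^sup>2)"
proof -
  assume f: "f \<in> V"
  have "Im (ip f f) = 0"
    using ip_cnj[OF f f] by (metis cnj.simps(2) equal_neg_zero)
  then show ?thesis
    by (simp add: complex_eq_iff norm_power2 f del: of_real_power)
qed

lemma norm_scale: "f \<in> V \<Longrightarrow> ip_norm ip (\<lambda>x. c * f x) = cmod c * ip_norm ip f"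
proof -
  assume f: "f \<in> V"
  have "ip (\<lambda>x. c * f x) (\<lambda>x. c * f x) = of_real ((cmod c * ip_norm ip f)\<^sup>2)"
    using f by (simp add: scale_mem ip_scale_left ip_scale_right ip_self power_mult_distrib
        mult.assoc[symmetric] complex_norm_square[symmetric])
  then show ?thesis
    using f norm_ge_0[OF f] by (simp add: ip_norm_def del: of_real_power of_real_mult)
qed

lemma norm_diff_power2:
  assumes "f \<in> V" "g \<in> V"
  shows "(ip_norm ip (\<lambda>x. f x - g x))\<^sup>2
    = (ip_norm ip f)\<^sup>2 + (ip_norm ip g)\<^sup>2 - 2 * Re (ip f g)"
  using assms ip_cnj[of f g]
  by (simp add: norm_power2 diff_mem ip_diff_left ip_diff_right)

lemma norm_add_power2:
  assumes "f \<in> V" "g \<in> V"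
  shows "(ip_norm ip (\<lambda>x. f x + g x))\<^sup>2
    = (ip_norm ip f)\<^sup>2 + (ip_norm ip g)\<^sup>2 + 2 * Re (ip f g)"
  using assms ip_cnj[of f g]
  by (simp add: norm_power2 add_mem ip_add_left ip_add_right)

lemma norm_minus_commute:
  "f \<in> V \<Longrightarrow> g \<in> V \<Longrightarrow> ip_norm ip (\<lambda>x. f x - g x) = ip_norm ip (\<lambda>x. g x - f x)"
  using norm_scale[OF diff_mem[of f g], of "-1"] by simp

text \<open>
  Subtracting \<open>c g\<close> with the optimal \<open>c = \<langle>f, g\<rangle> / \<parallel>g\<parallel>\<^sup>2\<close> lowers \<open>\<parallel>f\<parallel>\<^sup>2\<close> by \<open>\<bar>\<langle>f, g\<rangle>\<bar>\<^sup>2 / \<parallel>g\<parallel>\<^sup>2\<close>;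
  so if no multiple of \<open>g\<close> lowers it by more than \<open>e\<close>, the inner product is small. With \<open>e = \<parallel>f\<parallel>\<^sup>2\<close> this is the
  Cauchy-Schwarz inequality, and for a minimising sequence it gives orthogonality in the limit.
\<close>
lemma almost_orthogonal:
  assumes f: "f \<in> V" and g: "g \<in> V" and e: "0 \<le> e"
    and min: "\<And>c. (ip_norm ip f)\<^sup>2 - e \<le> (ip_norm ip (\<lambda>x. f x - c * g x))\<^sup>2"
  shows "(cmod (ip f g))\<^sup>2 \<le> e * (ip_norm ip g)\<^sup>2"
proof -
  let ?G = "(ip_norm ip g)\<^sup>2" and ?p = "ip f g"
  have key: "2 * t * (cmod ?p)\<^sup>2 \<le> e + t\<^sup>2 * (cmod ?p)\<^sup>2 * ?G" for t :: real
  proof -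
    have "(ip_norm ip (\<lambda>x. f x - (of_real t * ?p) * g x))\<^sup>2
      = (ip_norm ip f)\<^sup>2 + t\<^sup>2 * (cmod ?p)\<^sup>2 * ?G - 2 * t * (cmod ?p)\<^sup>2"
    proof -
      have "Re (ip f (\<lambda>x. (of_real t * ?p) * g x)) = t * (cmod ?p)\<^sup>2"
        using f g by (simp add: ip_scale_right cmod_power2) (simp add: power2_eq_square algebra_simps)
      then show ?thesis
        unfolding norm_diff_power2[OF f scale_mem[OF g]] norm_scale[OF g]
        by (simp add: norm_mult power_mult_distrib)
    qed
    then show ?thesis using min[of "of_real t * ?p"] by linarith
  qed
  show ?thesis
  proof (cases "?G = 0")
    case True
    show ?thesis
    proof (rule ccontr)
      assume "\<not> ?thesis"
      then have p: "(cmod ?p)\<^sup>2 > 0" using True by simp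
      \<comment> \<open>For \<open>g\<close> of norm zero the inequality is linear in \<open>t\<close>, so a large \<open>t\<close> violates it.\<close>
      have "2 * ((e + 1) / (cmod ?p)\<^sup>2) * (cmod ?p)\<^sup>2 \<le> e"
        using key[of "(e + 1) / (cmod ?p)\<^sup>2"] True by simp
      then show False using p e by simp
    qed
  next
    case False
    then have "?G > 0" by simp
    have "P \<le> e * G" if "G > 0" "2 * (1 / G) * P \<le> e + (1 / G)\<^sup>2 * P * G" for P G :: real
      using that by (simp add: field_simps power2_eq_square)
    from this[OF \<open>?G > 0\<close> key[of "1 / ?G"]] show ?thesis .
  qed
qed

lemma cauchy_schwarz:
  assumes "f \<in> V" "g \<in> V"
  shows "cmod (ip f g) \<le> ip_norm ip f * ip_norm ip g"
proof (rule power2_le_imp_le)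
  show "(cmod (ip f g))\<^sup>2 \<le> (ip_norm ip f * ip_norm ip g)\<^sup>2"
    using almost_orthogonal[OF assms, of "(ip_norm ip f)\<^sup>2"] by (simp add: power_mult_distrib)
qed (use assms norm_ge_0 in auto)

lemma norm_triangle:
  assumes "f \<in> V" "g \<in> V"
  shows "ip_norm ip (\<lambda>x. f x + g x) \<le> ip_norm ip f + ip_norm ip g"
proof (rule power2_le_imp_le)
  have "Re (ip f g) \<le> ip_norm ip f * ip_norm ip g"
    using cauchy_schwarz[OF assms] complex_Re_le_cmod order_trans by blast
  then show "(ip_norm ip (\<lambda>x. f x + g x))\<^sup>2 \<le> (ip_norm ip f + ip_norm ip g)\<^sup>2"
    using assms by (simp add: norm_add_power2 power2_sum)
qed (use assms norm_ge_0 in auto)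

lemma tendsto_ip_left:
  assumes s: "\<And>n. s n \<in> V" and f: "f \<in> V" and g: "g \<in> V"
    and lim: "(\<lambda>n. ip_norm ip (\<lambda>x. s n x - f x)) \<longlonglongrightarrow> 0"
  shows "(\<lambda>n. ip (s n) g) \<longlonglongrightarrow> ip f g"
proof (rule LIM_zero_cancel, rule Lim_null_comparison)
  show "\<forall>\<^sub>F n in sequentially. cmod (ip (s n) g - ip f g)
      \<le> ip_norm ip (\<lambda>x. s n x - f x) * ip_norm ip g"
    using cauchy_schwarz[OF diff_mem[OF s f] g] by (simp add: ip_diff_left s f g)
  show "(\<lambda>n. ip_norm ip (\<lambda>x. s n x - f x) * ip_norm ip g) \<longlonglongrightarrow> 0"
    using tendsto_mult_left_zero[OF lim] .
qed

lemma tendsto_norm: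
  assumes s: "\<And>n. s n \<in> V" and f: "f \<in> V"
    and lim: "(\<lambda>n. ip_norm ip (\<lambda>x. s n x - f x)) \<longlonglongrightarrow> 0"
  shows "(\<lambda>n. ip_norm ip (s n)) \<longlonglongrightarrow> ip_norm ip f"
proof (rule LIM_zero_cancel, rule Lim_null_comparison[OF _ lim], rule always_eventually, rule allI)
  fix n
  show "norm (ip_norm ip (s n) - ip_norm ip f) \<le> ip_norm ip (\<lambda>x. s n x - f x)"
    using norm_triangle[OF diff_mem[OF s[of n] f] f] norm_triangle[OF diff_mem[OF f s[of n]] s[of n]]
      norm_minus_commute[OF f s[of n]] by simp
qed

end

text \<open>
  The pairs formed by a finite linear combination of the \<open>u y\<close> and the one of the \<open>v y\<close> with the
  same coefficients. The inductive form avoids coefficient families, and it stays a relation because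
  one vector may have several representations.
\<close>
inductive matched_combination ::
    "'i set \<Rightarrow> ('i \<Rightarrow> 'a \<Rightarrow> complex) \<Rightarrow> ('i \<Rightarrow> 'b \<Rightarrow> complex) \<Rightarrow>
     ('a \<Rightarrow> complex) \<Rightarrow> ('b \<Rightarrow> complex) \<Rightarrow> bool"
  for Y u v where
  zero: "matched_combination Y u v (\<lambda>x. 0) (\<lambda>x. 0)"
| step: "matched_combination Y u v g G \<Longrightarrow> y \<in> Y \<Longrightarrow>
    matched_combination Y u v (\<lambda>x. g x + c * u y x) (\<lambda>x. G x + c * v y x)"

lemma matched_combination_scale:
  assumes "matched_combination Y u v g G"
  shows "matched_combination Y u v (\<lambda>x. c * g x) (\<lambda>x. c * G x)"
  using assms
proof induction
  case zero
  show ?case using matched_combination.zero by simp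
next
  case (step g G y d)
  then show ?case
    using matched_combination.step[of Y u v "\<lambda>x. c * g x" "\<lambda>x. c * G x" y "c * d"]
    by (simp add: algebra_simps)
qed

lemma matched_combination_add:
  assumes "matched_combination Y u v h H" and "matched_combination Y u v g G"
  shows "matched_combination Y u v (\<lambda>x. g x + h x) (\<lambda>x. G x + H x)"
  using assms
proof induction
  case (step h H y c)
  then show ?case
    using matched_combination.step[of Y u v "\<lambda>x. g x + h x" "\<lambda>x. G x + H x" y c]
    by (simp add: algebra_simps)
qed simp

lemma matched_combination_diff:
  assumes "matched_combination Y u v g G" and "matched_combination Y u v h H"
  shows "matched_combination Y u v (\<lambda>x. g x - h x) (\<lambda>x. G x - H x)"
  using matched_combination_add[OF matched_combination_scale[OF assms(2), of "-1"] assms(1)]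
  by simp

text \<open>
  Matched combinations have equal norms and equal pairings with the generators, as only the Gram
  matrix enters. Take matched pairs \<open>(g\<^sub>n, G\<^sub>n)\<close> such that the \<open>g\<^sub>n\<close> minimise the distance from \<open>f\<close>.
  By the parallelogram law the \<open>g\<^sub>n\<close> form a Cauchy sequence, hence so do the \<open>G\<^sub>n\<close>, and their limit
  \<open>F\<close> is the vector sought: \<open>f - g\<^sub>n\<close> becomes orthogonal to every generator, so the pairings of \<open>F\<close>
  are those of \<open>f\<close>. Totality of the \<open>u y\<close> identifies the limit of the \<open>g\<^sub>n\<close> with \<open>f\<close>, which is what
  makes the norms equal.
\<close>
lemma equal_gram_isometry:
  fixes u :: "'i \<Rightarrow> 'a \<Rightarrow> complex" and v :: "'i \<Rightarrow> 'b \<Rightarrow> complex"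
  assumes hilbert1: "hilbert_function_space X1 V1 ip1"
    and hilbert2: "hilbert_function_space X2 V2 ip2"
    and u: "\<And>y. y \<in> Y \<Longrightarrow> u y \<in> V1" and v: "\<And>y. y \<in> Y \<Longrightarrow> v y \<in> V2"
    and gram: "\<And>y z. y \<in> Y \<Longrightarrow> z \<in> Y \<Longrightarrow> ip1 (u y) (u z) = ip2 (v y) (v z)"
    and total: "\<And>h x. h \<in> V1 \<Longrightarrow> (\<And>y. y \<in> Y \<Longrightarrow> ip1 h (u y) = 0) \<Longrightarrow> x \<in> X1 \<Longrightarrow> h x = 0"
    and f: "f \<in> V1"
  shows "\<exists>F\<in>V2. (\<forall>y\<in>Y. ip2 F (v y) = ip1 f (u y)) \<and> ip_norm ip2 F = ip_norm ip1 f"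
proof -
  interpret L: hilbert_functions X1 V1 ip1 by standard (rule hilbert1)
  interpret R: hilbert_functions X2 V2 ip2 by standard (rule hilbert2)
  let ?M = "matched_combination Y u v"
  have mem: "g \<in> V1 \<and> G \<in> V2" if "?M g G" for g G
    using that by induction (simp_all add: L.add_mem L.scale_mem R.add_mem R.scale_mem
        L.zero_mem R.zero_mem u v)
  have ip_gen: "ip1 g (u y) = ip2 G (v y)" if "?M g G" "y \<in> Y" for g G y
    using that
  proof induction
    case zero
    then show ?case by (simp add: L.ip_zero_left R.ip_zero_left u v)
  next
    case (step g G z c)
    then show ?case using mem[of g G]
      by (simp add: L.ip_add_left R.ip_add_left L.ip_scale_left R.ip_scale_left u v
          L.scale_mem R.scale_mem gram)
  qed
  have norm_eq: "ip_norm ip1 g = ip_norm ip2 G" if gG: "?M g G" for g G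
  proof -
    have "ip1 g' g = ip2 G' G" if "?M g' G'" for g' G'
      using that
    proof induction
      case zero
      then show ?case using mem[OF gG] by (simp add: L.ip_zero_left R.ip_zero_left)
    next
      case (step g' G' z c)
      have "ip1 (u z) g = ip2 (v z) G"
        using step.hyps(2) ip_gen[OF gG] mem[OF gG] L.ip_cnj[of g "u z"] R.ip_cnj[of G "v z"] u v
        by simp
      then show ?case using mem[of g' G'] step mem[OF gG]
        by (simp add: L.ip_add_left R.ip_add_left L.ip_scale_left R.ip_scale_left u v
            L.scale_mem R.scale_mem)
    qed
    then show ?thesis using gG by (simp add: ip_norm_def)
  qed
  define D where "D = {(ip_norm ip1 (\<lambda>x. f x - g x))\<^sup>2 | g G. ?M g G}"
  define d where "d = Inf D"
  have D_ne: "D \<noteq> {}" and D_bdd: "bdd_below D"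
    unfolding D_def using matched_combination.zero[of Y u v] by (auto intro!: bdd_belowI[of _ 0])
  have d_le: "d \<le> (ip_norm ip1 (\<lambda>x. f x - g x))\<^sup>2" if "?M g G" for g G
    unfolding d_def using that D_bdd by (intro cInf_lower) (auto simp: D_def)
  have "\<exists>g G. ?M g G \<and> (ip_norm ip1 (\<lambda>x. f x - g x))\<^sup>2 < d + 1 / real (Suc n)" for n
    using cInf_lessD[OF D_ne, of "d + 1 / real (Suc n)"] unfolding d_def[symmetric]
    by (auto simp: D_def)
  then obtain g G where M: "\<And>n. ?M (g n) (G n)"
    and near: "\<And>n. (ip_norm ip1 (\<lambda>x. f x - g n x))\<^sup>2 < d + 1 / real (Suc n)"
    by metis
  have g: "g n \<in> V1" and G: "G n \<in> V2" for n using mem[OF M] by auto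
  \<comment> \<open>The midpoint of \<open>g m\<close> and \<open>g n\<close> is at distance at least \<open>\<surd>d\<close> from \<open>f\<close>; then the
    parallelogram law bounds the other diagonal.\<close>
  have small: "(ip_norm ip1 (\<lambda>x. g m x - g n x))\<^sup>2 \<le> 2 / real (Suc m) + 2 / real (Suc n)" for m n
  proof -
    let ?p = "\<lambda>x. f x - g n x" and ?q = "\<lambda>x. f x - g m x"
    have p: "?p \<in> V1" and q: "?q \<in> V1" by (auto intro: L.diff_mem f g)
    have "?M (\<lambda>x. (1/2) * (g n x + g m x)) (\<lambda>x. (1/2) * (G n x + G m x))"
      by (intro matched_combination_scale matched_combination_add M)
    from d_le[OF this]
    have "d \<le> (ip_norm ip1 (\<lambda>x. (1/2) * (?p x + ?q x)))\<^sup>2"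
      by (simp add: field_simps)
    also have "\<dots> = (1/4) * (ip_norm ip1 (\<lambda>x. ?p x + ?q x))\<^sup>2"
      by (subst L.norm_scale[OF L.add_mem[OF p q]]) (simp add: power2_eq_square)
    finally have "4 * d \<le> (ip_norm ip1 (\<lambda>x. ?p x + ?q x))\<^sup>2" by simp
    moreover have "(\<lambda>x. g m x - g n x) = (\<lambda>x. ?p x - ?q x)" by auto
    ultimately show ?thesis
      using near[of m] near[of n] L.norm_add_power2[OF p q] L.norm_diff_power2[OF p q] by simp
  qed
  have cauchy: "\<exists>N::nat. \<forall>m\<ge>N. \<forall>n\<ge>N. ip_norm ip1 (\<lambda>x. g m x - g n x) < e" if "e > 0" for e
  proof -
    obtain N :: nat where N: "4 / e\<^sup>2 < real N" using reals_Archimedean2 by blast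
    have "ip_norm ip1 (\<lambda>x. g m x - g n x) < e" if "m \<ge> N" "n \<ge> N" for m n
    proof (rule power2_less_imp_less)
      have *: "2 / real (Suc k) < e\<^sup>2 / 2" if "k \<ge> N" for k
      proof -
        have "4 / e\<^sup>2 < real (Suc k)" using that N by simp
        then show ?thesis using \<open>e > 0\<close> by (simp add: field_simps)
      qed
      show "(ip_norm ip1 (\<lambda>x. g m x - g n x))\<^sup>2 < e\<^sup>2"
        using small[of m n] *[OF that(1)] *[OF that(2)] by simp
    qed (use \<open>e > 0\<close> in simp)
    then show ?thesis by blast
  qed
  obtain h where h: "h \<in> V1" "(\<lambda>n. ip_norm ip1 (\<lambda>x. g n x - h x)) \<longlonglongrightarrow> 0"
    using L.complete[OF g cauchy] by blast
  have "ip_norm ip2 (\<lambda>x. G m x - G n x) = ip_norm ip1 (\<lambda>x. g m x - g n x)" for m n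
    using norm_eq[OF matched_combination_diff[OF M M]] by simp
  then obtain F where F: "F \<in> V2" "(\<lambda>n. ip_norm ip2 (\<lambda>x. G n x - F x)) \<longlonglongrightarrow> 0"
    using R.complete[of G] G cauchy by auto
  have to_f: "(\<lambda>n. ip1 (g n) (u y)) \<longlonglongrightarrow> ip1 f (u y)" if y: "y \<in> Y" for y
  proof -
    have bound: "(cmod (ip1 (\<lambda>x. f x - g n x) (u y)))\<^sup>2 \<le> 1 / real (Suc n) * (ip_norm ip1 (u y))\<^sup>2"
      for n
    proof (rule L.almost_orthogonal)
      fix c
      have "d \<le> (ip_norm ip1 (\<lambda>x. (f x - g n x) - c * u y x))\<^sup>2"
        using d_le[OF matched_combination.step[OF M[of n] y, of c]] by (simp add: diff_diff_eq)
      then show "(ip_norm ip1 (\<lambda>x. f x - g n x))\<^sup>2 - 1 / real (Suc n)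
          \<le> (ip_norm ip1 (\<lambda>x. f x - g n x - c * u y x))\<^sup>2"
        using near[of n] by linarith
    qed (use u y f g L.diff_mem in auto)
    have "(\<lambda>n. 1 / real (Suc n) * (ip_norm ip1 (u y))\<^sup>2) \<longlonglongrightarrow> 0"
      using LIMSEQ_inverse_real_of_nat
      by (intro tendsto_mult_left_zero) (simp add: inverse_eq_divide)
    then have "(\<lambda>n. (cmod (ip1 f (u y) - ip1 (g n) (u y)))\<^sup>2) \<longlonglongrightarrow> 0"
      by (rule Lim_null_comparison[rotated])
        (use bound u y f g in \<open>simp add: L.ip_diff_left\<close>)
    from tendsto_real_sqrt[OF this]
    have "(\<lambda>n. ip1 f (u y) - ip1 (g n) (u y)) \<longlonglongrightarrow> 0"
      by (simp add: tendsto_norm_zero_iff)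
    from tendsto_diff[OF tendsto_const[of "ip1 f (u y)"] this] show ?thesis by simp
  qed
  have pair: "ip2 F (v y) = ip1 f (u y)" if y: "y \<in> Y" for y
    using LIMSEQ_unique[OF R.tendsto_ip_left[OF G F(1) v[OF y] F(2)]] to_f[OF y]
    by (simp add: ip_gen[OF M y, symmetric])
  have "ip1 (\<lambda>x. f x - h x) (u y) = 0" if y: "y \<in> Y" for y
    using LIMSEQ_unique[OF L.tendsto_ip_left[OF g h(1) u[OF y] h(2)] to_f[OF y]]
    by (simp add: L.ip_diff_left f h(1) u[OF y])
  from total[OF L.diff_mem[OF f h(1)] this] have fh0: "ip_norm ip1 (\<lambda>x. h x - f x) = 0"
    using L.ip_self_eq_0[OF L.diff_mem[OF h(1) f]] by (simp add: ip_norm_def)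
  have "(\<lambda>n. ip_norm ip1 (\<lambda>x. g n x - f x)) \<longlonglongrightarrow> 0"
  proof (rule Lim_null_comparison[OF _ h(2)], rule always_eventually, rule allI)
    fix n
    show "norm (ip_norm ip1 (\<lambda>x. g n x - f x)) \<le> ip_norm ip1 (\<lambda>x. g n x - h x)"
      using L.norm_triangle[OF L.diff_mem[OF g[of n] h(1)] L.diff_mem[OF h(1) f]] fh0
        L.norm_ge_0[OF L.diff_mem[OF g[of n] f]] by simp
  qed
  from L.tendsto_norm[OF g f this] R.tendsto_norm[OF G F]
  have "ip_norm ip2 F = ip_norm ip1 f"
    using norm_eq[OF M] LIMSEQ_unique by auto
  then show ?thesis using F(1) pair by blast
qed

section \<open>Circle means and Parseval's identity\<close>

lemma circle_point_in_disc: "r \<in> {0..<1} \<Longrightarrow> of_real r * cis t \<in> unit_disc"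
  by (simp add: norm_mult)

lemma continuous_on_circle:
  assumes "continuous_on unit_disc f" "r \<in> {0..<1}"
  shows "continuous_on {0..2*pi} (\<lambda>t. f (of_real r * cis t))"
  by (rule continuous_on_compose2[OF assms(1)])
    (use circle_point_in_disc[OF assms(2)] in \<open>auto intro!: continuous_intros\<close>)

lemma has_integral_circle:
  fixes f :: "complex \<Rightarrow> 'b::euclidean_space"
  assumes "continuous_on unit_disc f" "r \<in> {0..<1}"
  shows "((\<lambda>t. f (of_real r * cis t)) has_integral (2 * pi) *\<^sub>R circle_mean f r) {0..2*pi}"
  using integrable_integral[OF integrable_continuous_interval[OF continuous_on_circle[OF assms]]]
  by (simp add: circle_mean_def)

lemma circle_mean_unique:
  assumes "((\<lambda>t. f (of_real r * cis t)) has_integral I) {0..2*pi}"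
  shows "circle_mean f r = (1 / (2 * pi)) *\<^sub>R I"
  using assms by (simp add: circle_mean_def integral_unique)

lemma circle_mean_linear:
  fixes f :: "complex \<Rightarrow> 'b::euclidean_space" and h :: "'b \<Rightarrow> 'c::euclidean_space"
  assumes "bounded_linear h" "continuous_on unit_disc f" "r \<in> {0..<1}"
  shows "circle_mean (\<lambda>z. h (f z)) r = h (circle_mean f r)"
  using circle_mean_unique[OF has_integral_linear[OF has_integral_circle[OF assms(2,3)] assms(1),
      unfolded o_def]]
  by (simp add: linear_simps[OF assms(1)])

lemma circle_mean_add:
  fixes f g :: "complex \<Rightarrow> 'b::euclidean_space"
  assumes "continuous_on unit_disc f" "continuous_on unit_disc g" "r \<in> {0..<1}"
  shows "circle_mean (\<lambda>z. f z + g z) r = circle_mean f r + circle_mean g r"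
  using circle_mean_unique[OF has_integral_add[OF has_integral_circle[OF assms(1,3)]
        has_integral_circle[OF assms(2,3)]]]
  by (simp add: scaleR_right_distrib)

lemma circle_mean_diff:
  fixes f g :: "complex \<Rightarrow> 'b::euclidean_space"
  assumes "continuous_on unit_disc f" "continuous_on unit_disc g" "r \<in> {0..<1}"
  shows "circle_mean (\<lambda>z. f z - g z) r = circle_mean f r - circle_mean g r"
  using circle_mean_unique[OF has_integral_diff[OF has_integral_circle[OF assms(1,3)]
        has_integral_circle[OF assms(2,3)]]]
  by (simp add: scaleR_right_diff_distrib)

lemma circle_mean_sum:
  fixes f :: "'i \<Rightarrow> complex \<Rightarrow> 'b::euclidean_space"
  assumes "finite J" "\<And>j. j \<in> J \<Longrightarrow> continuous_on unit_disc (f j)" "r \<in> {0..<1}"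
  shows "circle_mean (\<lambda>z. \<Sum>j\<in>J. f j z) r = (\<Sum>j\<in>J. circle_mean (f j) r)"
  using circle_mean_unique[OF has_integral_sum[OF assms(1) has_integral_circle[OF assms(2,3)]]]
  by (simp add: scaleR_sum_right)

lemma circle_mean_mono:
  fixes f g :: "complex \<Rightarrow> real"
  assumes "continuous_on unit_disc f" "continuous_on unit_disc g" "r \<in> {0..<1}"
    and "\<And>z. cmod z = r \<Longrightarrow> f z \<le> g z"
  shows "circle_mean f r \<le> circle_mean g r"
proof -
  have "(2 * pi) *\<^sub>R circle_mean f r \<le> (2 * pi) *\<^sub>R circle_mean g r"
    by (rule has_integral_le[OF has_integral_circle[OF assms(1,3)] has_integral_circle[OF assms(2,3)]])
      (use assms(3,4) in \<open>simp add: norm_mult\<close>)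
  then show ?thesis by simp
qed

lemma circle_mean_const:
  fixes c :: "'b::euclidean_space"
  shows "circle_mean (\<lambda>z. c) r = c"
  by (simp add: circle_mean_def)

lemma circle_mean_uniform_limit:
  fixes f :: "nat \<Rightarrow> complex \<Rightarrow> 'b::euclidean_space"
  assumes "uniform_limit (cball 0 r) f g sequentially"
    and "\<And>n. continuous_on unit_disc (f n)" and "continuous_on unit_disc g" and r: "r \<in> {0..<1}"
  shows "(\<lambda>n. circle_mean (f n) r) \<longlonglongrightarrow> circle_mean g r"
proof -
  have "uniform_limit {0..2*pi} (\<lambda>n t. f n (of_real r * cis t)) (\<lambda>t. g (of_real r * cis t)) sequentially"
    by (rule uniform_limit_compose'[OF assms(1)]) (use r in \<open>auto simp: norm_mult\<close>)
  then obtain I J where I: "\<And>n. ((\<lambda>t. f n (of_real r * cis t)) has_integral I n) {0..2*pi}"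
    and J: "((\<lambda>t. g (of_real r * cis t)) has_integral J) {0..2*pi}" and lim: "I \<longlonglongrightarrow> J"
    by (rule uniform_limit_integral[OF _ continuous_on_circle[OF assms(2) r] sequentially_bot]) blast
  show ?thesis
    using tendsto_scaleR[OF tendsto_const lim, of "1 / (2 * pi)"]
    by (simp add: circle_mean_unique[OF I] circle_mean_unique[OF J])
qed

text \<open>
  On the circle of radius \<open>r\<close> the product is \<open>r\<^bsup>m + n\<^esup> exp(i (m - n) t)\<close>, and a nontrivial
  exponential has a periodic antiderivative.
\<close>
lemma circle_mean_monomials:
  assumes r: "r \<in> {0..<1}"
  shows "circle_mean (\<lambda>z. z ^ m * cnj (z ^ n)) r = (if m = n then of_real (r ^ (2 * n)) else 0)"
proof -
  let ?k = "real m - real n"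
  have eq: "(of_real r * cis t) ^ m * cnj ((of_real r * cis t) ^ n)
      = of_real (r ^ (m + n)) * exp (\<i> * of_real ?k * of_real t)" for t
  proof -
    have "cis t ^ m * cis (- t) ^ n = exp (\<i> * of_real ?k * of_real t)"
    proof -
      have "real m * t + real n * - t = ?k * t" by (simp add: algebra_simps)
      then have "cis t ^ m * cis (- t) ^ n = cis (?k * t)" by (simp only: Complex.DeMoivre cis_mult)
      then show ?thesis by (simp only: cis_conv_exp of_real_mult mult.assoc)
    qed
    then show ?thesis by (simp add: power_mult_distrib power_add cis_cnj)
  qed
  show ?thesis
  proof (cases "m = n")
    case True
    have "(of_real r * cis t) ^ m * cnj ((of_real r * cis t) ^ n) = of_real (r ^ (2 * n))" for t
      unfolding eq using True by (simp add: mult_2)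
    then have "circle_mean (\<lambda>z. z ^ m * cnj (z ^ n)) r = of_real (r ^ (2 * n))"
      by (simp only: circle_mean_def) simp
    then show ?thesis unfolding if_P[OF True] .
  next
    case False
    then have k: "?k \<noteq> 0" by simp
    have "((\<lambda>z. exp (\<i> * of_real ?k * z) / (\<i> * of_real ?k)) has_field_derivative
        exp (\<i> * of_real ?k * z)) (at z within S)" for z S
      using k by (auto intro!: derivative_eq_intros)
    then have "((\<lambda>t. exp (\<i> * of_real ?k * of_real t) / (\<i> * of_real ?k)) has_vector_derivative
        exp (\<i> * of_real ?k * of_real t)) (at t within {0..2*pi})" for t
      using has_vector_derivative_real_field by blast
    from fundamental_theorem_of_calculus[OF _ this]
    have "((\<lambda>t. exp (\<i> * of_real ?k * of_real t)) has_integral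
        exp (\<i> * of_real ?k * of_real (2 * pi)) / (\<i> * of_real ?k)
        - exp (\<i> * of_real ?k * of_real 0) / (\<i> * of_real ?k)) {0..2*pi}"
      by simp
    moreover have "exp (\<i> * of_real ?k * of_real (2 * pi)) = 1"
    proof -
      have "exp (\<i> * of_real ?k * of_real (2 * pi)) = cis (2 * pi * ?k)"
        by (simp add: cis_conv_exp algebra_simps)
      then show ?thesis using cis_multiple_2pi[of ?k] by simp
  qed
    ultimately have "((\<lambda>t. exp (\<i> * of_real ?k * of_real t)) has_integral 0) {0..2*pi}" by simp
    from has_integral_mult_right[OF this, of "of_real (r ^ (m + n))"]
    have "((\<lambda>t. (of_real r * cis t) ^ m * cnj ((of_real r * cis t) ^ n)) has_integral 0) {0..2*pi}"
      unfolding eq by simp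
    from circle_mean_unique[OF this] show ?thesis using False by simp
  qed
qed

text \<open>
  The Taylor polynomials converge uniformly on the circle, and for them the identity is
  orthogonality of the monomials.
\<close>
lemma parseval_circle:
  assumes f: "f holomorphic_on unit_disc" and r: "r \<in> {0..<1}"
  shows "(\<lambda>n. (cmod ((deriv ^^ n) f 0 / fact n))\<^sup>2 * r ^ (2 * n)) sums
    circle_mean (\<lambda>z. (cmod (f z))\<^sup>2) r"
proof -
  define a where "a n = (deriv ^^ n) f 0 / fact n" for n
  define P where "P N z = (\<Sum>i<N. a i * z ^ i)" for N z
  have sums: "(\<lambda>n. a n * z ^ n) sums f z" if "z \<in> unit_disc" for z
    using holomorphic_power_series[OF f that] by (simp add: a_def)
  define R where "R = (1 + r) / 2"
  have R: "r < R" "0 \<le> R" "R < 1" using r by (auto simp: R_def)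
  then have "of_real R \<in> unit_disc" by simp
  from conv_radius_geI[OF sums_summable[OF sums[OF this]]]
  have "ereal R \<le> conv_radius a" using R by simp
  then have "ereal r < conv_radius a"
    using less_le_trans[of "ereal r" "ereal R" "conv_radius a"] R(1) by simp
  from powser_uniform_limit[OF this, of 0]
  have unif: "uniform_limit (cball 0 r) P f sequentially"
  proof -
    have "(\<Sum>i. a i * (z - 0) ^ i) = f z" if "z \<in> cball 0 r" for z
      using sums_unique[OF sums[of z]] r that by simp
    then show ?thesis
      using uniform_limit_cong'[of "cball 0 r" "\<lambda>n x. \<Sum>i<n. a i * (x - 0) ^ i" P
          "\<lambda>x. \<Sum>i. a i * (x - 0) ^ i" f sequentially]
        \<open>uniform_limit (cball 0 r) (\<lambda>n x. \<Sum>i<n. a i * (x - 0) ^ i) _ _\<close>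
      by (simp add: P_def)
  qed
  have cf: "continuous_on unit_disc f" using f holomorphic_on_imp_continuous_on by blast
  have cP: "continuous_on unit_disc (P N)" for N unfolding P_def by (intro continuous_intros)
  have bdd: "bounded (f ` cball 0 r)"
  proof -
    have "cball 0 r \<subseteq> unit_disc" using r by auto
    then show ?thesis
      using continuous_on_subset[OF cf] compact_continuous_image compact_imp_bounded compact_cball
      by blast
  qed
  have "(\<lambda>N. circle_mean (\<lambda>z. P N z * cnj (P N z)) r) \<longlonglongrightarrow> circle_mean (\<lambda>z. f z * cnj (f z)) r"
  proof (rule circle_mean_uniform_limit[OF _ _ _ r])
    have "bounded ((\<lambda>z. cnj (f z)) ` cball 0 r)"
      using bounded_linear_image[OF bdd bounded_linear_cnj] by (simp add: image_image)
    then show "uniform_limit (cball 0 r) (\<lambda>N z. P N z * cnj (P N z)) (\<lambda>z. f z * cnj (f z)) sequentially"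
      by (rule uniform_lim_mult[OF unif bounded_linear.uniform_limit[OF bounded_linear_cnj unif] bdd])
  qed (rule continuous_on_mult continuous_on_cnj cP cf)+
  moreover have "circle_mean (\<lambda>z. P N z * cnj (P N z)) r
      = of_real (\<Sum>i<N. (cmod (a i))\<^sup>2 * r ^ (2 * i))" for N
  proof -
    let ?t = "\<lambda>i j z. (a i * cnj (a j)) * (z ^ i * cnj (z ^ j))"
    have c: "continuous_on unit_disc (\<lambda>z. z ^ i * cnj (z ^ j))" for i j
      by (intro continuous_intros)
    have ct: "continuous_on unit_disc (?t i j)" for i j
      by (intro continuous_intros)
    have "P N z * cnj (P N z) = (\<Sum>i<N. \<Sum>j<N. ?t i j z)" for z
      by (simp add: P_def sum_product mult.assoc mult.left_commute)
    then have "circle_mean (\<lambda>z. P N z * cnj (P N z)) r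
        = circle_mean (\<lambda>z. \<Sum>i<N. \<Sum>j<N. ?t i j z) r"
      by (simp only:)
    also have "\<dots> = (\<Sum>i<N. circle_mean (\<lambda>z. \<Sum>j<N. ?t i j z) r)"
      by (rule circle_mean_sum[OF finite_lessThan _ r]) (rule continuous_on_sum, rule ct)
    also have "\<dots> = (\<Sum>i<N. \<Sum>j<N. circle_mean (?t i j) r)"
      by (rule sum.cong[OF refl], rule circle_mean_sum[OF finite_lessThan _ r], rule ct)
    also have "\<dots> = (\<Sum>i<N. \<Sum>j<N. if i = j then (a i * cnj (a i)) * of_real (r ^ (2 * i)) else 0)"
    proof (intro sum.cong refl)
      fix i j
      show "circle_mean (?t i j) r = (if i = j then (a i * cnj (a i)) * of_real (r ^ (2 * i)) else 0)"
        using circle_mean_linear[OF bounded_linear_mult_right[of "a i * cnj (a j)"] c[of i j] r]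
        unfolding circle_mean_monomials[OF r] by (auto split: if_splits)
    qed
    also have "\<dots> = (\<Sum>i<N. (a i * cnj (a i)) * of_real (r ^ (2 * i)))"
      by (rule sum.cong[OF refl]) (simp add: sum.delta)
    finally show ?thesis by (simp add: complex_norm_square[symmetric])
  qed
  moreover have "circle_mean (\<lambda>z. f z * cnj (f z)) r = of_real (circle_mean (\<lambda>z. (cmod (f z))\<^sup>2) r)"
    unfolding complex_norm_square[symmetric]
    by (rule circle_mean_linear[OF bounded_linear_of_real _ r]) (intro continuous_intros cf)
  ultimately have "(\<lambda>N. \<Sum>i<N. (cmod (a i))\<^sup>2 * r ^ (2 * i)) \<longlonglongrightarrow> circle_mean (\<lambda>z. (cmod (f z))\<^sup>2) r"
    by (simp only: tendsto_of_real_iff)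
  then show ?thesis by (simp add: sums_def a_def)
qed

section \<open>Character-automorphic Hardy spaces are Hilbert spaces\<close>

lemma continuous_on_norm_power2: "continuous_on A f \<Longrightarrow> continuous_on A (\<lambda>z. (cmod (f z))\<^sup>2)"
  by (intro continuous_intros)

lemma hardy2_continuous: "f \<in> hardy2 \<Longrightarrow> continuous_on unit_disc f"
  by (simp add: hardy2_def holomorphic_on_imp_continuous_on)

text \<open>
  By Parseval's identity the means are power series in \<open>r\<close> with nonnegative coefficients. So the
  supremum in the Hardy norm is a limit as \<open>r \<rightarrow> 1\<close>, which connects it with the inner product.
\<close>
lemma circle_mean_norm2_le:
  assumes f: "f holomorphic_on unit_disc" and "0 \<le> r" "r \<le> s" "s < 1"
  shows "circle_mean (\<lambda>z. (cmod (f z))\<^sup>2) r \<le> circle_mean (\<lambda>z. (cmod (f z))\<^sup>2) s"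
proof (rule sums_le[OF _ parseval_circle[OF f] parseval_circle[OF f]])
  fix n
  show "(cmod ((deriv ^^ n) f 0 / fact n))\<^sup>2 * r ^ (2 * n)
      \<le> (cmod ((deriv ^^ n) f 0 / fact n))\<^sup>2 * s ^ (2 * n)"
    using assms by (intro mult_left_mono power_mono) auto
qed (use assms in auto)

lemma hardy2_norm_power2:
  assumes "f \<in> hardy2"
  shows "(hardy2_norm f)\<^sup>2 = (SUP r\<in>{0..<1}. circle_mean (\<lambda>z. (cmod (f z))\<^sup>2) r)"
    and "r \<in> {0..<1} \<Longrightarrow> circle_mean (\<lambda>z. (cmod (f z))\<^sup>2) r \<le> (hardy2_norm f)\<^sup>2"
proof -
  let ?m = "circle_mean (\<lambda>z. (cmod (f z))\<^sup>2)"
  have le: "?m r \<le> (SUP r\<in>{0..<1}. ?m r)" if "r \<in> {0..<1}" for r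
    using assms that by (intro cSUP_upper) (auto simp: hardy2_def)
  have "0 \<le> ?m 0"
    using circle_mean_mono[of "\<lambda>z. 0" "\<lambda>z. (cmod (f z))\<^sup>2" 0]
    by (simp add: circle_mean_const continuous_on_norm_power2 hardy2_continuous[OF assms])
  then have "0 \<le> (SUP r\<in>{0..<1}. ?m r)" using le[of 0] by simp
  then show eq: "(hardy2_norm f)\<^sup>2 = (SUP r\<in>{0..<1}. ?m r)" by (simp add: hardy2_norm_def)
  show "r \<in> {0..<1} \<Longrightarrow> ?m r \<le> (hardy2_norm f)\<^sup>2" unfolding eq by (rule le)
qed

lemma eventually_radius_at_left: "\<forall>\<^sub>F r in at_left (1::real). r \<in> {0..<1}"
  using eventually_at_left_real[of 0 "1::real"] by (rule eventually_mono) auto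

lemma hardy2_norm_ge_0: "f \<in> hardy2 \<Longrightarrow> 0 \<le> hardy2_norm f"
proof -
  assume f: "f \<in> hardy2"
  have "0 \<le> (SUP r\<in>{0..<1}. circle_mean (\<lambda>z. (cmod (f z))\<^sup>2) r)"
    using hardy2_norm_power2(1)[OF f] by (metis zero_le_power2)
  then show ?thesis by (simp add: hardy2_norm_def)
qed

lemma hardy2_mean_tendsto:
  assumes f: "f \<in> hardy2"
  shows "(circle_mean (\<lambda>z. (cmod (f z))\<^sup>2) \<longlongrightarrow> (hardy2_norm f)\<^sup>2) (at_left 1)"
proof (rule order_tendstoI)
  let ?m = "circle_mean (\<lambda>z. (cmod (f z))\<^sup>2)"
  fix a assume "a < (hardy2_norm f)\<^sup>2"
  then obtain r where r: "r \<in> {0..<1}" "a < ?m r"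
    unfolding hardy2_norm_power2(1)[OF f]
    using f by (subst (asm) less_cSUP_iff) (auto simp: hardy2_def)
  have "\<forall>\<^sub>F s in at_left (1::real). s \<in> {r<..<1}"
    using r by (intro eventually_at_left_real) auto
  then show "\<forall>\<^sub>F s in at_left 1. a < ?m s"
  proof eventually_elim
    case (elim s)
    then have "?m r \<le> ?m s"
      using r f by (intro circle_mean_norm2_le) (auto simp: hardy2_def)
    then show ?case using r by simp
  qed
next
  fix a assume a: "(hardy2_norm f)\<^sup>2 < a"
  show "\<forall>\<^sub>F s in at_left 1. circle_mean (\<lambda>z. (cmod (f z))\<^sup>2) s < a"
    using eventually_radius_at_left
    by eventually_elim (rule le_less_trans[OF hardy2_norm_power2(2)[OF f] a])
qed

lemma hardy2_coeff_le:
  assumes f: "f \<in> hardy2"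
  shows "cmod ((deriv ^^ n) f 0 / fact n) \<le> hardy2_norm f"
proof -
  let ?a = "\<lambda>n. (cmod ((deriv ^^ n) f 0 / fact n))\<^sup>2"
  have hol: "f holomorphic_on unit_disc" using f by (simp add: hardy2_def)
  have "\<forall>\<^sub>F r in at_left (1::real). ?a n * r ^ (2 * n) \<le> (hardy2_norm f)\<^sup>2"
    using eventually_radius_at_left
  proof eventually_elim
    case (elim r)
    have s: "(\<lambda>n. ?a n * r ^ (2 * n)) sums circle_mean (\<lambda>z. (cmod (f z))\<^sup>2) r"
      by (rule parseval_circle[OF hol elim])
    have "sum (\<lambda>n. ?a n * r ^ (2 * n)) {n} \<le> suminf (\<lambda>n. ?a n * r ^ (2 * n))"
      using elim by (intro sum_le_suminf sums_summable[OF s]) auto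
    then show ?case
      using hardy2_norm_power2(2)[OF f elim] sums_unique[OF s] by simp
  qed
  moreover have "((\<lambda>r. ?a n * r ^ (2 * n)) \<longlongrightarrow> ?a n * 1 ^ (2 * n)) (at_left 1)"
    by (intro tendsto_intros)
  ultimately have "?a n * 1 ^ (2 * n) \<le> (hardy2_norm f)\<^sup>2"
    by (intro tendsto_upperbound) auto
  then have "?a n \<le> (hardy2_norm f)\<^sup>2" by simp
  then show ?thesis by (rule power2_le_imp_le[OF _ hardy2_norm_ge_0[OF f]])
qed

text \<open>
  Each Taylor coefficient is at most the norm, so a geometric series dominates the Taylor series.
  The bound is locally uniform in \<open>z\<close>: convergence in norm implies locally uniform convergence.
\<close>
lemma hardy2_evaluation_bound:
  assumes f: "f \<in> hardy2" and z: "z \<in> unit_disc"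
  shows "cmod (f z) \<le> hardy2_norm f / (1 - cmod z)"
proof -
  let ?a = "\<lambda>n. (deriv ^^ n) f 0 / fact n"
  have s: "(\<lambda>n. ?a n * (z - 0) ^ n) sums f z"
    using f z by (intro holomorphic_power_series[of f 0 1]) (auto simp: hardy2_def)
  have geo: "(\<lambda>n. hardy2_norm f * cmod z ^ n) sums (hardy2_norm f * (1 / (1 - cmod z)))"
    using z by (intro sums_mult geometric_sums) simp
  have "cmod (\<Sum>n. ?a n * (z - 0) ^ n) \<le> (\<Sum>n. hardy2_norm f * cmod z ^ n)"
  proof (rule norm_suminf_le)
    fix n
    have "cmod (?a n * (z - 0) ^ n) = cmod (?a n) * cmod z ^ n"
      by (simp only: norm_mult norm_power diff_0_right)
    also have "\<dots> \<le> hardy2_norm f * cmod z ^ n"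
      by (rule mult_right_mono[OF hardy2_coeff_le[OF f]]) simp
    finally show "cmod (?a n * (z - 0) ^ n) \<le> hardy2_norm f * cmod z ^ n" .
  qed (rule sums_summable[OF geo])
  then show ?thesis
    unfolding sums_unique[OF s, symmetric] sums_unique[OF geo, symmetric] by simp
qed

lemma hardy2I:
  assumes "f holomorphic_on unit_disc"
    and "\<And>r. r \<in> {0..<1} \<Longrightarrow> circle_mean (\<lambda>z. (cmod (f z))\<^sup>2) r \<le> c"
  shows "f \<in> hardy2" and "(hardy2_norm f)\<^sup>2 \<le> c"
proof -
  show f: "f \<in> hardy2" using assms by (auto simp: hardy2_def intro!: bdd_aboveI[of _ c])
  show "(hardy2_norm f)\<^sup>2 \<le> c"
    unfolding hardy2_norm_power2(1)[OF f] using assms(2) by (intro cSUP_least) auto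
qed

lemma norm_add_power2_le: "(cmod (a + b))\<^sup>2 \<le> 2 * (cmod a)\<^sup>2 + 2 * (cmod b)\<^sup>2"
proof -
  have "(cmod (a + b))\<^sup>2 \<le> (cmod a + cmod b)\<^sup>2"
    by (intro power_mono norm_triangle_ineq) simp
  also have "\<dots> \<le> 2 * (cmod a)\<^sup>2 + 2 * (cmod b)\<^sup>2"
    using zero_le_power2[of "cmod a - cmod b"] by (simp add: power2_eq_square algebra_simps)
  finally show ?thesis .
qed

lemma circle_mean_norm2_add_le:
  assumes f: "continuous_on unit_disc f" and g: "continuous_on unit_disc g" and r: "r \<in> {0..<1}"
  shows "circle_mean (\<lambda>z. (cmod (f z + g z))\<^sup>2) r
    \<le> 2 * circle_mean (\<lambda>z. (cmod (f z))\<^sup>2) r + 2 * circle_mean (\<lambda>z. (cmod (g z))\<^sup>2) r"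
proof -
  have "circle_mean (\<lambda>z. (cmod (f z + g z))\<^sup>2) r
      \<le> circle_mean (\<lambda>z. 2 * (cmod (f z))\<^sup>2 + 2 * (cmod (g z))\<^sup>2) r"
    by (rule circle_mean_mono[OF _ _ r norm_add_power2_le]) (intro continuous_intros f g)+
  also have "\<dots> = circle_mean (\<lambda>z. 2 * (cmod (f z))\<^sup>2) r + circle_mean (\<lambda>z. 2 * (cmod (g z))\<^sup>2) r"
    by (rule circle_mean_add[OF _ _ r]) (intro continuous_intros f g)+
  also have "\<dots> = 2 * circle_mean (\<lambda>z. (cmod (f z))\<^sup>2) r + 2 * circle_mean (\<lambda>z. (cmod (g z))\<^sup>2) r"
    using circle_mean_linear[OF bounded_linear_mult_right[of 2] continuous_on_norm_power2[OF f] r]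
      circle_mean_linear[OF bounded_linear_mult_right[of 2] continuous_on_norm_power2[OF g] r]
    by simp
  finally show ?thesis .
qed

lemma hardy2_add:
  assumes "f \<in> hardy2" "g \<in> hardy2"
  shows "(\<lambda>z. f z + g z) \<in> hardy2"
proof (rule hardy2I(1))
  show "(\<lambda>z. f z + g z) holomorphic_on unit_disc"
    using assms by (auto simp: hardy2_def intro!: holomorphic_intros)
  show "circle_mean (\<lambda>z. (cmod (f z + g z))\<^sup>2) r \<le> 2 * (hardy2_norm f)\<^sup>2 + 2 * (hardy2_norm g)\<^sup>2"
    if "r \<in> {0..<1}" for r
    using circle_mean_norm2_add_le[OF assms[THEN hardy2_continuous] that]
      assms[THEN hardy2_norm_power2(2), OF that] by linarith
qed

lemma hardy2_scale:
  assumes "f \<in> hardy2"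
  shows "(\<lambda>z. c * f z) \<in> hardy2"
proof (rule hardy2I(1))
  show "(\<lambda>z. c * f z) holomorphic_on unit_disc"
    using assms by (auto simp: hardy2_def intro!: holomorphic_intros)
  show "circle_mean (\<lambda>z. (cmod (c * f z))\<^sup>2) r \<le> (cmod c)\<^sup>2 * (hardy2_norm f)\<^sup>2" if "r \<in> {0..<1}" for r
    using circle_mean_linear[OF bounded_linear_mult_right
        continuous_on_norm_power2[OF hardy2_continuous[OF assms]] that, of "(cmod c)\<^sup>2"]
      mult_left_mono[OF hardy2_norm_power2(2)[OF assms that], of "(cmod c)\<^sup>2"]
    by (simp add: norm_mult power_mult_distrib)
qed

text \<open>
  The limit that defines the inner product exists: by polarization the mean of \<open>f g\<^sup>*\<close> is a
  combination of means of squared moduli, each of which is monotone and bounded.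
\<close>
lemma hardy2_inner_tendsto:
  assumes f: "f \<in> hardy2" and g: "g \<in> hardy2"
  shows "(circle_mean (\<lambda>z. f z * cnj (g z)) \<longlongrightarrow> hardy2_inner f g) (at_left 1)"
proof -
  let ?m = "\<lambda>f. circle_mean (\<lambda>z. (cmod (f z))\<^sup>2)"
  define d where "d c z = ((cmod (f z + c * g z))\<^sup>2 - (cmod (f z))\<^sup>2 - (cmod (g z))\<^sup>2) / 2" for c z
  note cont = f[THEN hardy2_continuous] g[THEN hardy2_continuous]
  \<comment> \<open>\<open>d 1\<close> and \<open>d \<i>\<close> are the real and the imaginary part of \<open>f g\<^sup>*\<close>.\<close>
  have polar: "f z * cnj (g z) = of_real (d 1 z) + \<i> * of_real (d \<i> z)" for z
    unfolding d_def cmod_power2 by (simp add: complex_eq_iff power2_eq_square algebra_simps)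
  have cd: "continuous_on unit_disc (d c)" for c
    unfolding d_def by (intro continuous_intros cont) auto
  have mean_d: "circle_mean (d c) r = (?m (\<lambda>z. f z + c * g z) r - ?m f r - ?m g r) / 2"
    if r: "r \<in> {0..<1}" for c r
  proof -
    have c: "continuous_on unit_disc (\<lambda>z. (cmod (f z + c * g z))\<^sup>2)"
      "continuous_on unit_disc (\<lambda>z. (cmod (f z))\<^sup>2)" "continuous_on unit_disc (\<lambda>z. (cmod (g z))\<^sup>2)"
      by (intro continuous_intros cont)+
    have "circle_mean (d c) r
        = circle_mean (\<lambda>z. (cmod (f z + c * g z))\<^sup>2 - (cmod (f z))\<^sup>2 - (cmod (g z))\<^sup>2) r / 2"
      unfolding d_def
      by (rule circle_mean_linear[OF bounded_linear_divide _ r]) (intro continuous_on_diff c)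
    also have "circle_mean (\<lambda>z. (cmod (f z + c * g z))\<^sup>2 - (cmod (f z))\<^sup>2 - (cmod (g z))\<^sup>2) r
        = ?m (\<lambda>z. f z + c * g z) r - ?m f r - ?m g r"
      by (simp only: circle_mean_diff[OF continuous_on_diff[OF c(1,2)] c(3) r]
          circle_mean_diff[OF c(1,2) r])
    finally show ?thesis .
  qed
  have lim_d: "\<exists>l. (circle_mean (d c) \<longlongrightarrow> l) (at_left 1)" for c
  proof -
    have fg: "(\<lambda>z. f z + c * g z) \<in> hardy2" by (intro hardy2_add hardy2_scale f g)
    have "((\<lambda>r. (?m (\<lambda>z. f z + c * g z) r - ?m f r - ?m g r) / 2) \<longlongrightarrow>
        ((hardy2_norm (\<lambda>z. f z + c * g z))\<^sup>2 - (hardy2_norm f)\<^sup>2 - (hardy2_norm g)\<^sup>2) / 2) (at_left 1)"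
      by (intro tendsto_divide tendsto_diff tendsto_const hardy2_mean_tendsto fg f g) simp
    then have "(circle_mean (d c) \<longlongrightarrow>
        ((hardy2_norm (\<lambda>z. f z + c * g z))\<^sup>2 - (hardy2_norm f)\<^sup>2 - (hardy2_norm g)\<^sup>2) / 2) (at_left 1)"
      by (rule Lim_transform_eventually)
        (use eventually_radius_at_left in eventually_elim, simp only: mean_d)
    then show ?thesis by blast
  qed
  obtain l1 l2 where l: "(circle_mean (d 1) \<longlongrightarrow> l1) (at_left 1)" "(circle_mean (d \<i>) \<longlongrightarrow> l2) (at_left 1)"
    using lim_d by meson
  have mean: "circle_mean (\<lambda>z. f z * cnj (g z)) r
      = of_real (circle_mean (d 1) r) + \<i> * of_real (circle_mean (d \<i>) r)" if r: "r \<in> {0..<1}" for r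
  proof -
    have c1: "continuous_on unit_disc (\<lambda>z. of_real (d c z) :: complex)" for c
      by (intro continuous_intros cd)
    have c2: "continuous_on unit_disc (\<lambda>z. \<i> * of_real (d c z))" for c
      by (intro continuous_intros c1)
    show ?thesis
      unfolding polar circle_mean_add[OF c1 c2 r]
        circle_mean_linear[OF bounded_linear_mult_right c1 r]
        circle_mean_linear[OF bounded_linear_of_real cd r] ..
  qed
  have "((\<lambda>r. of_real (circle_mean (d 1) r) + \<i> * of_real (circle_mean (d \<i>) r))
      \<longlongrightarrow> of_real l1 + \<i> * of_real l2) (at_left 1)"
    by (intro tendsto_intros l)
  then have "(circle_mean (\<lambda>z. f z * cnj (g z)) \<longlongrightarrow> of_real l1 + \<i> * of_real l2) (at_left 1)"
  proof (rule Lim_transform_eventually)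
    show "\<forall>\<^sub>F r in at_left 1. of_real (circle_mean (d 1) r) + \<i> * of_real (circle_mean (d \<i>) r)
        = circle_mean (\<lambda>z. f z * cnj (g z)) r"
      using eventually_radius_at_left by eventually_elim (rule mean[symmetric])
  qed
  then show ?thesis unfolding hardy2_inner_def by (simp add: tendsto_Lim)
qed

lemma hardy2_inner_self:
  assumes f: "f \<in> hardy2"
  shows "hardy2_inner f f = of_real ((hardy2_norm f)\<^sup>2)"
proof (rule tendsto_unique[OF _ hardy2_inner_tendsto[OF f f]])
  show "(circle_mean (\<lambda>z. f z * cnj (f z)) \<longlongrightarrow> of_real ((hardy2_norm f)\<^sup>2)) (at_left 1)"
  proof (rule Lim_transform_eventually[OF tendsto_of_real[OF hardy2_mean_tendsto[OF f]]])
    show "\<forall>\<^sub>F r in at_left 1. of_real (circle_mean (\<lambda>z. (cmod (f z))\<^sup>2) r)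
        = circle_mean (\<lambda>z. f z * cnj (f z)) r"
      using eventually_radius_at_left
      unfolding complex_norm_square[symmetric]
      by eventually_elim
        (simp only: circle_mean_linear[OF bounded_linear_of_real
            continuous_on_norm_power2[OF hardy2_continuous[OF f]]])
  qed
qed simp

lemma hardy2_ip_norm: "f \<in> hardy2 \<Longrightarrow> ip_norm hardy2_inner f = hardy2_norm f"
  by (simp add: ip_norm_def hardy2_inner_self hardy2_norm_ge_0 del: of_real_power)

lemma hardy2_diff: "f \<in> hardy2 \<Longrightarrow> g \<in> hardy2 \<Longrightarrow> (\<lambda>z. f z - g z) \<in> hardy2"
  using hardy2_add[OF _ hardy2_scale[of g "-1"], of f] by simp

lemma hardy2_inner_eqI:
  assumes "f \<in> hardy2" "g \<in> hardy2" "(u \<longlongrightarrow> l) (at_left 1)"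
    and "\<And>r. r \<in> {0..<1} \<Longrightarrow> circle_mean (\<lambda>z. f z * cnj (g z)) r = u r"
  shows "hardy2_inner f g = l"
proof (rule tendsto_unique[OF _ hardy2_inner_tendsto[OF assms(1,2)]])
  show "(circle_mean (\<lambda>z. f z * cnj (g z)) \<longlongrightarrow> l) (at_left 1)"
  proof (rule Lim_transform_eventually[OF assms(3)])
    show "\<forall>\<^sub>F r in at_left 1. u r = circle_mean (\<lambda>z. f z * cnj (g z)) r"
      using eventually_radius_at_left by eventually_elim (rule assms(4)[symmetric])
  qed
qed simp

lemma continuous_on_hardy2_product:
  "f \<in> hardy2 \<Longrightarrow> g \<in> hardy2 \<Longrightarrow> continuous_on unit_disc (\<lambda>z. f z * cnj (g z))"
  by (intro continuous_on_mult continuous_on_cnj hardy2_continuous)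

lemma hardy2_inner_add_left:
  assumes "f \<in> hardy2" "g \<in> hardy2" "h \<in> hardy2"
  shows "hardy2_inner (\<lambda>z. f z + g z) h = hardy2_inner f h + hardy2_inner g h"
  by (rule hardy2_inner_eqI[OF hardy2_add[OF assms(1,2)] assms(3)
        tendsto_add[OF hardy2_inner_tendsto[OF assms(1,3)] hardy2_inner_tendsto[OF assms(2,3)]]])
    (simp only: distrib_right circle_mean_add[OF continuous_on_hardy2_product[OF assms(1,3)]
      continuous_on_hardy2_product[OF assms(2,3)]])

lemma hardy2_inner_scale_left:
  assumes "f \<in> hardy2" "g \<in> hardy2"
  shows "hardy2_inner (\<lambda>z. c * f z) g = c * hardy2_inner f g"
  by (rule hardy2_inner_eqI[OF hardy2_scale[OF assms(1)] assms(2)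
        tendsto_mult_left[OF hardy2_inner_tendsto[OF assms]]])
    (simp only: mult.assoc circle_mean_linear[OF bounded_linear_mult_right
      continuous_on_hardy2_product[OF assms]])

lemma hardy2_inner_cnj:
  assumes "f \<in> hardy2" "g \<in> hardy2"
  shows "hardy2_inner g f = cnj (hardy2_inner f g)"
proof (rule hardy2_inner_eqI[OF assms(2,1) tendsto_cnj[OF hardy2_inner_tendsto[OF assms]]])
  fix r :: real assume "r \<in> {0..<1}"
  from circle_mean_linear[OF bounded_linear_cnj continuous_on_hardy2_product[OF assms] this]
  show "circle_mean (\<lambda>z. g z * cnj (f z)) r = cnj (circle_mean (\<lambda>z. f z * cnj (g z)) r)"
    by (simp add: mult.commute)
qed

lemma hardy2_norm_eq_0:
  assumes f: "f \<in> hardy2"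
  shows "hardy2_norm f = 0 \<longleftrightarrow> (\<forall>z\<in>unit_disc. f z = 0)"
proof
  assume "hardy2_norm f = 0"
  then show "\<forall>z\<in>unit_disc. f z = 0"
    using hardy2_evaluation_bound[OF f] by simp
next
  assume 0: "\<forall>z\<in>unit_disc. f z = 0"
  have "circle_mean (\<lambda>z. (cmod (f z))\<^sup>2) r = 0" if "r \<in> {0..<1}" for r
    unfolding circle_mean_def using 0 circle_point_in_disc[OF that] by simp
  then have "(hardy2_norm f)\<^sup>2 \<le> 0"
    by (intro hardy2I(2)) (use f in \<open>auto simp: hardy2_def\<close>)
  then show "hardy2_norm f = 0" by simp
qed

text \<open>
  The evaluation bound turns a Cauchy sequence in norm into a locally uniformly convergent one, whose
  limit is analytic. On a fixed circle \<open>s n - f\<close> is compared with \<open>s n - s m\<close> for an \<open>m\<close> that may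
  depend on the circle; the resulting bound of the mean does not depend on it.
\<close>
lemma hardy2_complete:
  assumes s: "\<And>n. s n \<in> hardy2"
    and cauchy: "\<And>e. e > 0 \<Longrightarrow> \<exists>N::nat. \<forall>m\<ge>N. \<forall>n\<ge>N. hardy2_norm (\<lambda>z. s m z - s n z) < e"
  obtains f where "f \<in> hardy2" "(\<lambda>n. hardy2_norm (\<lambda>z. s n z - f z)) \<longlonglongrightarrow> 0"
    and "\<And>z. z \<in> unit_disc \<Longrightarrow> (\<lambda>n. s n z) \<longlonglongrightarrow> f z"
proof -
  have eval: "cmod (s m z - s n z) \<le> hardy2_norm (\<lambda>z. s m z - s n z) / (1 - cmod z)"
    if "z \<in> unit_disc" for m n z
    using hardy2_evaluation_bound[OF hardy2_diff[OF s s] that] .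
  have "Cauchy (\<lambda>n. s n z)" if z: "z \<in> unit_disc" for z
  proof (rule CauchyI)
    fix e :: real assume "e > 0"
    then have "e * (1 - cmod z) > 0" using z by simp
    from cauchy[OF this] obtain N
      where N: "\<And>m n. m \<ge> N \<Longrightarrow> n \<ge> N \<Longrightarrow> hardy2_norm (\<lambda>z. s m z - s n z) < e * (1 - cmod z)"
      by blast
    have "cmod (s m z - s n z) < e" if "m \<ge> N" "n \<ge> N" for m n
    proof -
      have "hardy2_norm (\<lambda>z. s m z - s n z) / (1 - cmod z) < e"
        using N[OF that] z by (simp add: pos_divide_less_eq)
      then show ?thesis using eval[OF z] by (rule le_less_trans[rotated])
    qed
    then show "\<exists>M. \<forall>m\<ge>M. \<forall>n\<ge>M. cmod (s m z - s n z) < e" by blast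
  qed
  then have "\<exists>l. (\<lambda>n. s n z) \<longlonglongrightarrow> l" if "z \<in> unit_disc" for z
    using that Cauchy_convergent_iff convergent_def by blast
  then obtain f where f: "\<And>z. z \<in> unit_disc \<Longrightarrow> (\<lambda>n. s n z) \<longlonglongrightarrow> f z" by metis
  have eval_lim: "\<exists>N. \<forall>n\<ge>N. \<forall>z\<in>unit_disc. cmod (s n z - f z) \<le> e / (1 - cmod z)" if e: "e > 0" for e
  proof -
    obtain N where N: "\<And>m n. m \<ge> N \<Longrightarrow> n \<ge> N \<Longrightarrow> hardy2_norm (\<lambda>z. s m z - s n z) < e"
      using cauchy[OF e] by blast
    have "cmod (s n z - f z) \<le> e / (1 - cmod z)" if "n \<ge> N" and z: "z \<in> unit_disc" for n z
    proof (rule LIMSEQ_le_const2)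
      show "(\<lambda>m. cmod (s n z - s m z)) \<longlonglongrightarrow> cmod (s n z - f z)"
        by (intro tendsto_intros f z)
      have "cmod (s n z - s m z) \<le> e / (1 - cmod z)" if "m \<ge> N" for m
        using eval[OF z, of n m] N[OF \<open>n \<ge> N\<close> that] z
        by (intro order_trans[OF eval[OF z]] divide_right_mono) auto
      then show "\<exists>N. \<forall>m\<ge>N. cmod (s n z - s m z) \<le> e / (1 - cmod z)" by blast
    qed
    then show ?thesis by blast
  qed
  have unif: "uniform_limit (cball 0 r) s f sequentially" if r: "r < 1" for r
  proof (rule uniform_limitI)
    fix e :: real assume "e > 0"
    then have "e / 2 * (1 - r) > 0" using r by simp
    from eval_lim[OF this] obtain N
      where N: "\<And>n z. n \<ge> N \<Longrightarrow> z \<in> unit_disc \<Longrightarrow> cmod (s n z - f z) \<le> e / 2 * (1 - r) / (1 - cmod z)"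
      by blast
    have "dist (s n z) (f z) < e" if "n \<ge> N" "z \<in> cball 0 r" for n z
    proof -
      have z: "cmod z \<le> r" using that by simp
      have "cmod (s n z - f z) \<le> e / 2 * (1 - r) / (1 - cmod z)"
        using N[OF that(1), of z] z r by simp
      also have "\<dots> \<le> e / 2 * (1 - r) / (1 - r)"
        using z r \<open>e > 0\<close> by (intro divide_left_mono) auto
      also have "\<dots> = e / 2" using r by (intro nonzero_mult_div_cancel_right) simp
      also have "\<dots> < e" using \<open>e > 0\<close> by simp
      finally show ?thesis by (simp add: dist_norm)
    qed
    then show "\<forall>\<^sub>F n in sequentially. \<forall>z\<in>cball 0 r. dist (s n z) (f z) < e"
      unfolding eventually_sequentially by blast
  qed
  have hol: "f holomorphic_on unit_disc"
  proof (rule holomorphic_uniform_sequence[OF open_ball])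
    show "s n holomorphic_on unit_disc" for n using s by (simp add: hardy2_def)
    fix z :: complex assume z: "z \<in> unit_disc"
    define d where "d = (1 - cmod z) / 2"
    have d: "0 < d" "cmod z + d < 1" using z by (auto simp: d_def field_simps)
    have sub: "cball z d \<subseteq> cball 0 (cmod z + d)"
      by (simp add: cball_subset_cball_iff)
    moreover have "cball 0 (cmod z + d) \<subseteq> unit_disc" using d(2) by auto
    ultimately have "cball z d \<subseteq> unit_disc" by (rule order_trans)
    then show "\<exists>d>0. cball z d \<subseteq> unit_disc \<and> uniform_limit (cball z d) s f sequentially"
      using d(1) uniform_limit_on_subset[OF unif[OF d(2)] sub] by blast
  qed
  have mean_le: "\<exists>N. \<forall>n\<ge>N. \<forall>r\<in>{0..<1}. circle_mean (\<lambda>z. (cmod (s n z - f z))\<^sup>2) r \<le> (2 * e)\<^sup>2"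
    if e: "e > 0" for e
  proof -
    obtain N where N: "\<And>m n. m \<ge> N \<Longrightarrow> n \<ge> N \<Longrightarrow> hardy2_norm (\<lambda>z. s m z - s n z) < e"
      using cauchy[OF e] by blast
    have "circle_mean (\<lambda>z. (cmod (s n z - f z))\<^sup>2) r \<le> (2 * e)\<^sup>2" if n: "n \<ge> N" and r: "r \<in> {0..<1}" for n r
    proof -
      have "e * (1 - r) > 0" using e r by simp
      \<comment> \<open>On the circle of radius \<open>r\<close> the evaluation bound then gives \<open>\<bar>s m - f\<bar> \<le> e\<close>.\<close>
      from eval_lim[OF this] obtain M where
        M: "\<And>m z. m \<ge> M \<Longrightarrow> z \<in> unit_disc \<Longrightarrow> cmod (s m z - f z) \<le> e * (1 - r) / (1 - cmod z)"
        by blast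
      define m where "m = max M N"
      have cont: "continuous_on unit_disc (\<lambda>z. s n z - s m z)" "continuous_on unit_disc (\<lambda>z. s m z - f z)"
        by (intro continuous_on_diff hardy2_continuous s holomorphic_on_imp_continuous_on[OF hol])+
      have "circle_mean (\<lambda>z. (cmod (s m z - f z))\<^sup>2) r \<le> circle_mean (\<lambda>z. e\<^sup>2) r"
      proof (rule circle_mean_mono[OF continuous_on_norm_power2[OF cont(2)] continuous_on_const r])
        fix z assume z: "cmod z = r"
        have "cmod (s m z - f z) \<le> e * (1 - r) / (1 - cmod z)"
          using z r by (intro M) (auto simp: m_def)
        also have "\<dots> = e" using z r by simp
        finally show "(cmod (s m z - f z))\<^sup>2 \<le> e\<^sup>2" by (intro power_mono) auto
      qed
      moreover have "circle_mean (\<lambda>z. (cmod (s n z - s m z))\<^sup>2) r \<le> e\<^sup>2"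
      proof -
        have "hardy2_norm (\<lambda>z. s n z - s m z) < e" by (rule N) (use n in \<open>auto simp: m_def\<close>)
        then have "(hardy2_norm (\<lambda>z. s n z - s m z))\<^sup>2 \<le> e\<^sup>2"
          using hardy2_norm_ge_0[OF hardy2_diff[OF s s]] by (intro power_mono) auto
        then show ?thesis using hardy2_norm_power2(2)[OF hardy2_diff[OF s s] r, of n m] by linarith
      qed
      moreover have "circle_mean (\<lambda>z. (cmod (s n z - f z))\<^sup>2) r
          \<le> 2 * circle_mean (\<lambda>z. (cmod (s n z - s m z))\<^sup>2) r + 2 * circle_mean (\<lambda>z. (cmod (s m z - f z))\<^sup>2) r"
        using circle_mean_norm2_add_le[OF cont r] by simp
      ultimately show ?thesis by (simp add: circle_mean_const power_mult_distrib)
    qed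
    then show ?thesis by blast
  qed
  obtain N where "\<And>r. r \<in> {0..<1} \<Longrightarrow> circle_mean (\<lambda>z. (cmod (s N z - f z))\<^sup>2) r \<le> (2 * 1)\<^sup>2"
    using mean_le[of 1] by fastforce
  moreover have "(\<lambda>z. s N z - f z) holomorphic_on unit_disc"
    by (rule holomorphic_on_diff[OF _ hol]) (use s in \<open>simp add: hardy2_def\<close>)
  ultimately have "(\<lambda>z. s N z - f z) \<in> hardy2" by (rule hardy2I(1)[rotated])
  from hardy2_diff[OF s[of N] this] have fh: "f \<in> hardy2" by simp
  have "(\<lambda>n. hardy2_norm (\<lambda>z. s n z - f z)) \<longlonglongrightarrow> 0"
  proof (rule LIMSEQ_I)
    fix e :: real assume e: "e > 0"
    then have "e / 4 > 0" by simp
    from mean_le[OF this] obtain N where N: "\<And>n r. n \<ge> N \<Longrightarrow> r \<in> {0..<1} \<Longrightarrow>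
        circle_mean (\<lambda>z. (cmod (s n z - f z))\<^sup>2) r \<le> (2 * (e / 4))\<^sup>2" by blast
    have "norm (hardy2_norm (\<lambda>z. s n z - f z) - 0) < e" if "n \<ge> N" for n
    proof -
      have d: "(\<lambda>z. s n z - f z) \<in> hardy2" by (rule hardy2_diff[OF s fh])
      have "(hardy2_norm (\<lambda>z. s n z - f z))\<^sup>2 \<le> (2 * (e / 4))\<^sup>2"
        by (rule hardy2I(2)[OF _ N[OF that]]) (use d in \<open>simp_all add: hardy2_def\<close>)
      then have "hardy2_norm (\<lambda>z. s n z - f z) \<le> 2 * (e / 4)"
        by (rule power2_le_imp_le) (use e in simp)
      then show ?thesis using e hardy2_norm_ge_0[OF d] by simp
    qed
    then show "\<exists>N. \<forall>n\<ge>N. norm (hardy2_norm (\<lambda>z. s n z - f z) - 0) < e" by blast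
  qed
  then show thesis using that fh f by blast
qed

text \<open>
  Automorphy is a pointwise condition and hence preserved by limits in norm. Invariance of the disc
  ensures that it refers only to points where the limit is controlled.
\<close>
lemma character_hardy2_hilbert:
  assumes inv: "\<And>\<gamma> z. \<gamma> \<in> \<Gamma> \<Longrightarrow> z \<in> unit_disc \<Longrightarrow> \<gamma> z \<in> unit_disc"
  shows "hilbert_function_space unit_disc (character_hardy2 \<Gamma> \<alpha>) hardy2_inner"
proof -
  let ?V = "character_hardy2 \<Gamma> \<alpha>"
  have V: "f \<in> hardy2" if "f \<in> ?V" for f using that by (simp add: character_hardy2_def)
  have zero: "(\<lambda>z. 0) \<in> ?V"
    by (auto simp: character_hardy2_def circle_mean_const intro!: hardy2I(1)[of _ 0])
  have add: "(\<lambda>z. f z + g z) \<in> ?V" if "f \<in> ?V" "g \<in> ?V" for f g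
    using that by (auto simp: character_hardy2_def hardy2_add algebra_simps)
  have scale: "(\<lambda>z. c * f z) \<in> ?V" if "f \<in> ?V" for f c
    using that by (auto simp: character_hardy2_def hardy2_scale)
  have complete: "\<exists>f\<in>?V. (\<lambda>n. ip_norm hardy2_inner (\<lambda>x. s n x - f x)) \<longlonglongrightarrow> 0"
    if s: "\<And>n. s n \<in> ?V"
      and c: "\<forall>e>0. \<exists>N::nat. \<forall>m\<ge>N. \<forall>n\<ge>N. ip_norm hardy2_inner (\<lambda>x. s m x - s n x) < e" for s
  proof -
    have sh: "s n \<in> hardy2" for n using V[OF s] .
    have norm: "ip_norm hardy2_inner (\<lambda>x. s m x - f x) = hardy2_norm (\<lambda>x. s m x - f x)"
      if "f \<in> hardy2" for m f
      by (rule hardy2_ip_norm[OF hardy2_diff[OF sh that]])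
    have "\<exists>N::nat. \<forall>m\<ge>N. \<forall>n\<ge>N. hardy2_norm (\<lambda>x. s m x - s n x) < e" if "e > 0" for e
      using c that by (simp add: norm[OF sh])
    from hardy2_complete[OF sh this] obtain f where f: "f \<in> hardy2"
      "(\<lambda>n. hardy2_norm (\<lambda>z. s n z - f z)) \<longlonglongrightarrow> 0"
      "\<And>z. z \<in> unit_disc \<Longrightarrow> (\<lambda>n. s n z) \<longlonglongrightarrow> f z" by blast
    have "f (\<gamma> z) = \<alpha> \<gamma> * f z" if "\<gamma> \<in> \<Gamma>" "z \<in> unit_disc" for \<gamma> z
    proof (rule LIMSEQ_unique)
      show "(\<lambda>n. s n (\<gamma> z)) \<longlonglongrightarrow> f (\<gamma> z)" by (rule f(3)[OF inv[OF that]])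
      have "s n (\<gamma> z) = \<alpha> \<gamma> * s n z" for n using s that by (simp add: character_hardy2_def)
      then show "(\<lambda>n. s n (\<gamma> z)) \<longlonglongrightarrow> \<alpha> \<gamma> * f z" by (simp add: tendsto_mult_left f(3)[OF that(2)])
    qed
    then have "f \<in> ?V" using f(1) by (simp add: character_hardy2_def)
    then show ?thesis using f(2) by (intro bexI[of _ f]) (simp_all add: norm[OF f(1)])
  qed
  have self: "0 \<le> Re (hardy2_inner f f)"
    "hardy2_inner f f = 0 \<longleftrightarrow> (\<forall>z\<in>unit_disc. f z = 0)" if "f \<in> ?V" for f
    using hardy2_norm_eq_0[OF V[OF that]] by (simp_all add: hardy2_inner_self[OF V[OF that]])
  show ?thesis
    unfolding hilbert_function_space_def
  proof (intro conjI ballI allI impI)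
    fix s assume "(\<forall>n. s n \<in> ?V) \<and>
      (\<forall>e>0. \<exists>N::nat. \<forall>m\<ge>N. \<forall>n\<ge>N. ip_norm hardy2_inner (\<lambda>x. s m x - s n x) < e)"
    then show "\<exists>f\<in>?V. (\<lambda>n. ip_norm hardy2_inner (\<lambda>x. s n x - f x)) \<longlonglongrightarrow> 0"
      using complete[of s] by blast
  qed (rule zero add scale self hardy2_inner_add_left hardy2_inner_scale_left hardy2_inner_cnj V
      | assumption)+
qed

section \<open>The covering map and its upper half\<close>

lemma fuchsian_group_maps_disc:
  assumes "fuchsian_group \<Gamma>" "\<gamma> \<in> \<Gamma>" "z \<in> unit_disc"
  shows "\<gamma> z \<in> unit_disc"
  using assms unfolding fuchsian_group_def disc_moebius_def by blast

text \<open>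
  The factor of the identity vanishes at \<open>0\<close>, so all products over large finite subsets do.
\<close>
lemma green_0:
  assumes "fuchsian_group \<Gamma>"
  shows "green \<Gamma> 0 = 0"
proof -
  let ?e = "\<one>\<^bsub>BijGroup closed_disc\<^esub>"
  have e: "?e \<in> \<Gamma>"
    using assms unfolding fuchsian_group_def by (blast dest: subgroup.one_closed)
  have e0: "?e 0 = 0" by (simp add: BijGroup_def)
  have "(\<Prod>\<gamma>\<in>F. blaschke_factor (\<gamma> 0) 0) = 0" if "finite F" "{?e} \<subseteq> F" for F
    using that by (intro prod_zero) (auto simp: blaschke_factor_def e0 intro!: bexI[of _ ?e])
  then have "\<forall>\<^sub>F F in finite_subsets_at_top \<Gamma>. (\<Prod>\<gamma>\<in>F. blaschke_factor (\<gamma> 0) 0) = 0"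
    unfolding eventually_finite_subsets_at_top using e by (intro exI[of _ "{?e}"]) blast
  from tendsto_Lim[OF finite_subsets_at_top_neq_bot tendsto_eventually[OF this]]
  show ?thesis by (simp add: green_def)
qed

lemma covering_locally_injective:
  assumes "universal_covering_map \<Gamma> E \<zz>" "z \<in> unit_disc"
  obtains T where "open T" "z \<in> T" "T \<subseteq> unit_disc" "inj_on (to_sphere \<zz>) T"
proof -
  have "covering_space unit_disc (to_sphere \<zz>) (sphere 0 1 - stereo ` E)"
    using assms by (simp add: universal_covering_map_def)
  from covering_space_local_homeomorphism[OF this assms(2)] obtain T U q where
    T: "z \<in> T" "openin (top_of_set unit_disc) T" and h: "homeomorphism T U (to_sphere \<zz>) q"
    by metis
  from h have "inj_on (to_sphere \<zz>) T"
    unfolding homeomorphism_def by (metis inj_on_inverseI)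
  moreover have "open T" "T \<subseteq> unit_disc"
    using T(2) by (auto simp: openin_open_eq)
  ultimately show ?thesis using that T(1) by blast
qed

text \<open>
  Off the poles equality of the values of \<open>\<zz>\<close> is equality of their images on the sphere, which
  local injectivity excludes.
\<close>
lemma covering_not_constant:
  assumes cov: "universal_covering_map \<Gamma> E \<zz>"
    and U: "open U" "U \<subseteq> unit_disc" "x \<in> U" and hol: "\<zz> holomorphic_on U"
  shows "\<not> \<zz> constant_on U"
proof
  assume "\<zz> constant_on U"
  then obtain c where c: "\<And>y. y \<in> U \<Longrightarrow> \<zz> y = c" by (auto simp: constant_on_def)
  have "x \<in> unit_disc" using U by blast
  from covering_locally_injective[OF cov this]
  obtain T where T: "open T" "x \<in> T" "T \<subseteq> unit_disc" "inj_on (to_sphere \<zz>) T" .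
  have "x islimpt (T \<inter> U)"
    using T U by (intro interior_limit_point) (simp add: interior_open open_Int)
  then obtain y where y: "y \<in> T \<inter> U" "y \<noteq> x"
    using islimptE[of x "T \<inter> U" UNIV] by auto
  have "to_sphere \<zz> y = to_sphere \<zz> x"
    using y U(3) c not_is_pole_holomorphic[OF U(1) _ hol] by (simp add: to_sphere_def)
  then show False using T y unfolding inj_on_def by blast
qed

lemma nonpole_neighbourhood:
  assumes cov: "universal_covering_map \<Gamma> E \<zz>" and x: "x \<in> unit_disc" "\<not> is_pole \<zz> x"
  obtains r where "r > 0" "ball x r \<subseteq> unit_disc" "\<zz> holomorphic_on ball x r"
proof -
  have "\<zz> analytic_on {x}"
    using cov x by (auto simp: universal_covering_map_def intro: nicely_meromorphic_on_imp_analytic_at)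
  then obtain s where s: "s > 0" "\<zz> holomorphic_on ball x s" by (auto simp: analytic_on_def)
  obtain t where t: "t > 0" "ball x t \<subseteq> unit_disc"
    using openE[OF open_ball x(1)] by metis
  show ?thesis
  proof (rule that[of "min s t"])
    show "min s t > 0" using s t by simp
    show "ball x (min s t) \<subseteq> unit_disc" using t(2) by (meson min.cobounded2 order_trans subset_ball)
    show "\<zz> holomorphic_on ball x (min s t)"
      by (rule holomorphic_on_subset[OF s(2) subset_ball]) simp
  qed
qed

lemma covering_open_map:
  assumes cov: "universal_covering_map \<Gamma> E \<zz>"
    and "r > 0" "ball x r \<subseteq> unit_disc" "\<zz> holomorphic_on ball x r"
  shows "open (\<zz> ` ball x r)"
  by (rule open_mapping_thm[OF assms(4)])
    (use covering_not_constant[OF cov open_ball assms(3) _ assms(4), of x] assms(2) in auto)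

lemma Omega_plus_neighbourhood:
  assumes cov: "universal_covering_map \<Gamma> E \<zz>" and x: "x \<in> Omega_plus \<zz>"
  obtains r where "r > 0" "ball x r \<subseteq> Omega_plus \<zz>" "\<zz> holomorphic_on ball x r"
proof -
  have x': "x \<in> unit_disc" "\<not> is_pole \<zz> x" "Im (\<zz> x) > 0" using x by (auto simp: Omega_plus_def)
  obtain s where s: "s > 0" "ball x s \<subseteq> unit_disc" "\<zz> holomorphic_on ball x s"
    using nonpole_neighbourhood[OF cov x'(1,2)] .
  have "open (ball x s \<inter> \<zz> -` {w. Im w > 0})"
    by (rule continuous_open_preimage[OF holomorphic_on_imp_continuous_on[OF s(3)] open_ball
          open_halfspace_Im_gt])
  moreover have "x \<in> ball x s \<inter> \<zz> -` {w. Im w > 0}" using s(1) x'(3) by simp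
  ultimately obtain r where r: "r > 0" "ball x r \<subseteq> ball x s \<inter> \<zz> -` {w. Im w > 0}"
    unfolding open_contains_ball by blast
  show ?thesis
  proof (rule that[OF r(1)])
    show "ball x r \<subseteq> Omega_plus \<zz>"
      using r(2) s(2) not_is_pole_holomorphic[OF open_ball _ s(3)] unfolding Omega_plus_def by blast
    show "\<zz> holomorphic_on ball x r" using holomorphic_on_subset[OF s(3)] r(2) by blast
  qed
qed

lemma open_Omega_plus:
  assumes "universal_covering_map \<Gamma> E \<zz>"
  shows "open (Omega_plus \<zz>)"
  unfolding open_contains_ball by (meson Omega_plus_neighbourhood[OF assms])

lemma open_contains_imaginary_shift:
  assumes "open U" "w \<in> U"
  obtains e where "e > 0" "w + of_real e * \<i> \<in> U" "w - of_real e * \<i> \<in> U"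
proof -
  obtain r where r: "r > 0" "ball w r \<subseteq> U" using assms open_contains_ball by blast
  have "w + of_real (r / 2) * \<i> \<in> ball w r" "w - of_real (r / 2) * \<i> \<in> ball w r"
    using r(1) by (auto simp: dist_norm norm_mult norm_divide)
  then show ?thesis using that[of "r / 2"] r(1) subsetD[OF r(2)] by simp
qed

text \<open>
  At a pole \<open>1 / \<zz>\<close> extends to an open map with value \<open>0\<close>; it takes values \<open>-i e\<close> with \<open>e > 0\<close>,
  and there \<open>\<zz> = i / e\<close>. The extension has the values \<open>inverse (\<zz> z)\<close> even at the pole, where
  \<open>\<zz>\<close> has the default value \<open>0\<close>.
\<close>
lemma Omega_plus_nonempty_of_pole:
  assumes cov: "universal_covering_map \<Gamma> E \<zz>" and pole: "is_pole \<zz> x" and x: "x \<in> unit_disc"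
  shows "Omega_plus \<zz> \<noteq> {}"
proof -
  have nice: "\<zz> nicely_meromorphic_on unit_disc" using cov by (simp add: universal_covering_map_def)
  have value_at_pole: "\<zz> y = 0" if "y \<in> unit_disc" "is_pole \<zz> y" for y
  proof -
    have "\<not> \<zz> \<midarrow>y\<rightarrow> \<zz> y"
      using that(2) not_tendsto_and_filterlim_at_infinity[OF at_neq_bot] unfolding is_pole_def by blast
    then show ?thesis using nice that(1) unfolding nicely_meromorphic_on_def by blast
  qed
  let ?h = "\<lambda>z. inverse (\<zz> z)"
  have lim: "?h \<midarrow>x\<rightarrow> 0" using is_pole_tendsto[OF pole] by (simp add: o_def)
  have "\<not> is_pole ?h x"
    using lim not_tendsto_and_filterlim_at_infinity[OF at_neq_bot] unfolding is_pole_def by blast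
  then have "?h analytic_on {x}"
    using nicely_meromorphic_on_imp_analytic_at[OF nicely_meromorphic_on_inverse[OF nice] x] by blast
  then obtain s where s: "s > 0" "?h holomorphic_on ball x s" by (auto simp: analytic_on_def)
  obtain t where t: "t > 0" "ball x t \<subseteq> unit_disc"
    using openE[OF open_ball x] by metis
  define r where "r = min s t"
  have r: "r > 0" "ball x r \<subseteq> unit_disc" "?h holomorphic_on ball x r"
    using s t holomorphic_on_subset[OF s(2), of "ball x r"]
      subset_ball[of r t x] subset_ball[of r s x] by (auto simp: r_def)
  have "\<not> ?h constant_on ball x r"
  proof
    assume "?h constant_on ball x r"
    then have h0: "?h y = 0" if "y \<in> ball x r" for y
      using that r(1) value_at_pole[OF x pole] unfolding constant_on_def
      by (metis centre_in_ball inverse_zero)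
    then have "\<forall>\<^sub>F y in at x. \<zz> y = 0"
      using eventually_at_ball[OF r(1), of x UNIV] by (auto elim: eventually_mono)
    then have "\<zz> \<midarrow>x\<rightarrow> 0" by (rule tendsto_eventually)
    then show False
      using pole not_tendsto_and_filterlim_at_infinity[OF at_neq_bot] unfolding is_pole_def by blast
  qed
  then have "open (?h ` ball x r)"
    using open_mapping_thm[OF r(3) open_ball _ open_ball order_refl] by auto
  moreover have "0 \<in> ?h ` ball x r"
    using r(1) value_at_pole[OF x pole] by (intro image_eqI[of _ _ x]) auto
  ultimately obtain e where e: "e > 0" "0 - of_real e * \<i> \<in> ?h ` ball x r"
    using open_contains_imaginary_shift by metis
  then obtain y where y: "y \<in> ball x r" "?h y = - of_real e * \<i>" by auto
  have zy: "\<zz> y = of_real (1 / e) * \<i>"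
  proof -
    have "\<zz> y = inverse (- of_real e * \<i>)" using arg_cong[OF y(2), of inverse] by simp
    then show ?thesis by (simp add: divide_inverse mult.commute)
  qed
  then have "Im (\<zz> y) > 0" "\<zz> y \<noteq> 0" using e(1) by auto
  then have "y \<in> Omega_plus \<zz>"
    using y(1) r(2) value_at_pole unfolding Omega_plus_def by blast
  then show ?thesis by blast
qed

lemma kernel_formulaD:
  assumes "kernel_formula \<Gamma> \<zz> k \<mu> \<alpha>" "z \<in> unit_disc" "\<omega> \<in> unit_disc"
    and "\<not> is_pole \<zz> z" "\<not> is_pole \<zz> \<omega>" "\<zz> z \<noteq> cnj (\<zz> \<omega>)"
  shows "k \<alpha> z \<omega> = of_real (c_const \<Gamma> \<zz> k \<mu> \<alpha>) *
    ((kernel_quotient \<Gamma> k \<mu> \<alpha> z * cnj (k \<alpha> \<omega> 0) -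
      cnj (kernel_quotient \<Gamma> k \<mu> \<alpha> \<omega>) * k \<alpha> z 0) / (\<zz> z - cnj (\<zz> \<omega>)))"
  using assms unfolding kernel_formula_def by blast

text \<open>
  Being open, the covering map takes values in the upper half plane near a pole and near a point with
  a real value. If \<open>\<zz>(0)\<close> were finite and not real,
  the kernel formula would apply at \<open>(0, 0)\<close> and yield \<open>k\<^sup>\<alpha>(0, 0) = 0\<close>: since \<open>b(0) = 0\<close>, the quotient
  by \<open>b\<close> has the default value \<open>0\<close> there.
\<close>
lemma Omega_plus_nonempty:
  assumes cov: "universal_covering_map \<Gamma> E \<zz>" and fuchsian: "fuchsian_group \<Gamma>"
    and form: "kernel_formula \<Gamma> \<zz> k \<mu> \<alpha>" and k0: "k \<alpha> 0 0 \<noteq> 0"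
  shows "Omega_plus \<zz> \<noteq> {}"
proof (cases "is_pole \<zz> 0")
  case True
  show ?thesis by (rule Omega_plus_nonempty_of_pole[OF cov True]) simp
next
  case False
  have "\<zz> 0 = cnj (\<zz> 0)"
  proof (rule ccontr)
    assume "\<zz> 0 \<noteq> cnj (\<zz> 0)"
    have "k \<alpha> 0 0 = of_real (c_const \<Gamma> \<zz> k \<mu> \<alpha>) *
        ((kernel_quotient \<Gamma> k \<mu> \<alpha> 0 * cnj (k \<alpha> 0 0) -
          cnj (kernel_quotient \<Gamma> k \<mu> \<alpha> 0) * k \<alpha> 0 0) / (\<zz> 0 - cnj (\<zz> 0)))"
      by (rule kernel_formulaD[OF form]) (use False \<open>\<zz> 0 \<noteq> cnj (\<zz> 0)\<close> in simp_all)
    also have "\<dots> = 0" by (simp add: kernel_quotient_def green_0[OF fuchsian])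
    finally show False using k0 by simp
  qed
  then have im0: "Im (\<zz> 0) = 0" by (simp add: complex_eq_iff)
  obtain r where r: "r > 0" "ball 0 r \<subseteq> unit_disc" "\<zz> holomorphic_on ball 0 r"
    using nonpole_neighbourhood[OF cov _ False] by auto
  have "\<zz> 0 \<in> \<zz> ` ball 0 r" using r(1) by simp
  from open_contains_imaginary_shift[OF covering_open_map[OF cov r] this]
  obtain e where e: "e > 0" "\<zz> 0 + of_real e * \<i> \<in> \<zz> ` ball 0 r" by blast
  then obtain y where y: "y \<in> ball 0 r" "\<zz> y = \<zz> 0 + of_real e * \<i>" by auto
  have "Im (\<zz> y) > 0" using y(2) e(1) im0 by simp
  then have "y \<in> Omega_plus \<zz>"
    using y(1) r(2) not_is_pole_holomorphic[OF open_ball y(1) r(3)] unfolding Omega_plus_def by blast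
  then show ?thesis by blast
qed

lemma cayley_denominator_nonzero: "Im w > 0 \<Longrightarrow> 1 - \<i> * w \<noteq> 0"
  by (auto simp: complex_eq_iff)

lemma cayley_in_disc:
  assumes "Im w > 0"
  shows "(1 + \<i> * w) / (1 - \<i> * w) \<in> unit_disc"
proof -
  have "(cmod (1 + \<i> * w))\<^sup>2 < (cmod (1 - \<i> * w))\<^sup>2"
    using assms unfolding cmod_power2 by (simp add: power2_eq_square algebra_simps)
  then have "cmod (1 + \<i> * w) < cmod (1 - \<i> * w)" by (rule power2_less_imp_less) simp
  moreover have "0 < cmod (1 - \<i> * w)" using cayley_denominator_nonzero[OF assms] by simp
  ultimately show ?thesis by (simp add: norm_divide)
qed

lemma cayley_inj:
  assumes "1 - \<i> * v \<noteq> 0" "1 - \<i> * w \<noteq> 0"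
    and "(1 + \<i> * v) / (1 - \<i> * v) = (1 + \<i> * w) / (1 - \<i> * w)"
  shows "v = w"
proof -
  have "(1 + \<i> * v) * (1 - \<i> * w) = (1 + \<i> * w) * (1 - \<i> * v)"
    using assms by (simp add: frac_eq_eq)
  then have "2 * \<i> * (v - w) = 0" by (simp add: algebra_simps)
  then show ?thesis by simp
qed

text \<open>
  The set \<open>\<sigma>(\<Omega>)\<close> contains a nonempty open set because \<open>\<sigma>\<close> is analytic and, like \<open>\<zz>\<close>, not locally
  constant.
\<close>
lemma cayley_image_uniqueness:
  assumes cov: "universal_covering_map \<Gamma> E \<zz>" and ne: "Omega_plus \<zz> \<noteq> {}"
    and f: "f holomorphic_on unit_disc"
    and zero: "\<And>y. y \<in> Omega_plus \<zz> \<Longrightarrow> f (cayley_zz \<zz> y) = 0" and x: "x \<in> unit_disc"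
  shows "f x = 0"
proof -
  obtain y where "y \<in> Omega_plus \<zz>" using ne by blast
  from Omega_plus_neighbourhood[OF cov this] obtain r where
    r: "r > 0" "ball y r \<subseteq> Omega_plus \<zz>" "\<zz> holomorphic_on ball y r" .
  let ?B = "ball y r" and ?s = "cayley_zz \<zz>"
  have im: "Im (\<zz> v) > 0" if "v \<in> ?B" for v using r(2) that by (auto simp: Omega_plus_def)
  have nz: "1 - \<i> * \<zz> v \<noteq> 0" if "v \<in> ?B" for v using cayley_denominator_nonzero[OF im[OF that]] .
  have hol: "?s holomorphic_on ?B"
    unfolding cayley_zz_def by (intro holomorphic_intros r(3)) (use nz in auto)
  have "\<not> ?s constant_on ?B"
  proof
    assume "?s constant_on ?B"
    then obtain c where c: "\<And>v. v \<in> ?B \<Longrightarrow> ?s v = c" by (auto simp: constant_on_def)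
    have "\<zz> v = \<zz> y" if "v \<in> ?B" for v
      using cayley_inj[OF nz[OF that] nz[of y]] c[OF that] c[of y] r(1) by (simp add: cayley_zz_def)
    then have "\<zz> constant_on ?B" by (auto simp: constant_on_def)
    moreover have "?B \<subseteq> unit_disc" using r(2) by (auto simp: Omega_plus_def)
    ultimately show False using covering_not_constant[OF cov open_ball _ _ r(3), of y] r(1) by auto
  qed
  then have op: "open (?s ` ?B)"
    using open_mapping_thm[OF hol open_ball _ open_ball order_refl] by auto
  show ?thesis
  proof (rule analytic_continuation_open[OF op open_ball _ _ _ f holomorphic_on_const _ x])
    show "?s ` ?B \<noteq> {}" using r(1) by auto
    show "?s ` ?B \<subseteq> unit_disc" using cayley_in_disc[OF im] by (auto simp: cayley_zz_def)
    show "f w = 0" if "w \<in> ?s ` ?B" for w using that zero r(2) by auto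
  qed simp
qed

lemma Omega_plus_uniqueness:
  assumes cov: "universal_covering_map \<Gamma> E \<zz>" and ne: "Omega_plus \<zz> \<noteq> {}"
    and "F holomorphic_on unit_disc" "G holomorphic_on unit_disc"
    and "\<And>y. y \<in> Omega_plus \<zz> \<Longrightarrow> F y = G y" and "x \<in> unit_disc"
  shows "F x = G x"
  by (rule analytic_continuation_open[OF open_Omega_plus[OF cov] open_ball ne _ _ assms(3-6)])
    (auto simp: Omega_plus_def)

section \<open>The kernel identity and the transform\<close>

lemma cayley_kernel_denominator:
  "(1 - \<i> * p) * (1 + \<i> * q) - (1 + \<i> * p) * (1 - \<i> * q) = - 2 * \<i> * (p - q)"
  by (simp add: algebra_simps)

text \<open>
  The conjugated quantities enter as independent variables \<open>q\<close>, \<open>Q'\<close>, \<open>\<kappa>'\<close>, \<open>A'\<close>, \<open>B'\<close>. Both sides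
  come from the two identities \<open>A A' - B B' = -2 i s\<^sup>2 (Q \<kappa>' - Q' \<kappa>)\<close> and
  \<open>(1 - i p) (1 + i q) - (1 + i p) (1 - i q) = -2 i (p - q)\<close>.
\<close>
lemma kernel_factorization_identity:
  fixes p q Q Q' \<kappa> \<kappa>' s t :: complex
  assumes A: "A = s * (Q + \<i> * \<kappa>)" and B: "B = s * (Q - \<i> * \<kappa>)"
    and A': "A' = s * (Q' - \<i> * \<kappa>')" and B': "B' = s * (Q' + \<i> * \<kappa>')"
    and nz: "A \<noteq> 0" "A' \<noteq> 0" "1 - \<i> * p \<noteq> 0" "1 + \<i> * q \<noteq> 0" "p \<noteq> q" and t: "t * t = 2"
  shows "(t * A / (1 - \<i> * p)) * ((1 - (B / A) * (B' / A')) /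
      (1 - ((1 + \<i> * p) / (1 - \<i> * p)) * ((1 - \<i> * q) / (1 + \<i> * q)))) * (t * A' / (1 + \<i> * q))
    = 2 * s\<^sup>2 * ((Q * \<kappa>' - Q' * \<kappa>) / (p - q))"
proof -
  let ?N = "1 - \<i> * p" and ?M = "1 + \<i> * q" 
  let ?D = "- 2 * \<i> * (p - q)"
  have frac: "1 - (x / n) * (y / m) = (n * m - x * y) / (n * m)" if "n \<noteq> 0" "m \<noteq> 0" for x y n m :: complex
    using that by (simp add: field_simps)
  have cancel: "(t * a / n) * ((x / (a * b)) / (d / (n * m))) * (t * b / m) = (t * t) * x / d"
    if "a \<noteq> 0" "b \<noteq> 0" "n \<noteq> 0" "m \<noteq> 0" "d \<noteq> 0" for a b n m x d :: complex
    using that by (simp add: field_simps)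
  have D: "1 - ((1 + \<i> * p) / ?N) * ((1 - \<i> * q) / ?M) = ?D / (?N * ?M)"
    unfolding frac[OF nz(3,4)] cayley_kernel_denominator ..
  have D_nz: "?D \<noteq> 0" using nz(5) by simp
  have num: "1 - (B / A) * (B' / A') = (A * A' - B * B') / (A * A')"
    by (rule frac[OF nz(1,2)])
  have AB: "A * A' - B * B' = - 2 * \<i> * s\<^sup>2 * (Q * \<kappa>' - Q' * \<kappa>)"
    unfolding A B A' B' by (simp add: algebra_simps power2_eq_square)
  have "(t * A / ?N) * (((A * A' - B * B') / (A * A')) / (?D / (?N * ?M))) * (t * A' / ?M)
      = (t * t) * (A * A' - B * B') / ?D"
    by (rule cancel[OF nz(1,2,3,4) D_nz])
  also have "\<dots> = 2 * s\<^sup>2 * ((Q * \<kappa>' - Q' * \<kappa>) / (p - q))"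
    unfolding t AB using nz by (simp add: divide_simps)
  finally show ?thesis unfolding D num .
qed

lemma character_hardy2_cong:
  assumes fuchsian: "fuchsian_group \<Gamma>"
    and F: "F \<in> character_hardy2 \<Gamma> \<alpha>" and G: "G holomorphic_on unit_disc"
    and eq: "\<And>z. z \<in> unit_disc \<Longrightarrow> F z = G z"
  shows "G \<in> character_hardy2 \<Gamma> \<alpha>" and "hardy2_norm G = hardy2_norm F"
proof -
  have "circle_mean (\<lambda>z. (cmod (G z))\<^sup>2) r = circle_mean (\<lambda>z. (cmod (F z))\<^sup>2) r"
    if "r \<in> {0..<1}" for r
    unfolding circle_mean_def using eq circle_point_in_disc[OF that] by simp
  then have m: "circle_mean (\<lambda>z. (cmod (G z))\<^sup>2) ` {0..<1}
      = circle_mean (\<lambda>z. (cmod (F z))\<^sup>2) ` {0..<1}"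
    by (intro image_cong) auto
  have "G (\<gamma> z) = \<alpha> \<gamma> * G z" if "\<gamma> \<in> \<Gamma>" "z \<in> unit_disc" for \<gamma> z
  proof -
    have "F (\<gamma> z) = \<alpha> \<gamma> * F z" using F that by (simp add: character_hardy2_def)
    then show ?thesis by (simp only: eq[OF that(2)] eq[OF fuchsian_group_maps_disc[OF fuchsian that]])
  qed
  then show "G \<in> character_hardy2 \<Gamma> \<alpha>"
    using F G by (simp add: character_hardy2_def hardy2_def m)
  show "hardy2_norm G = hardy2_norm F" by (simp add: hardy2_norm_def m)
qed

definition transform_weight ::
    "(complex \<Rightarrow> complex) set \<Rightarrow> (complex \<Rightarrow> complex) \<Rightarrow> char_kernel \<Rightarrow>
     ((complex \<Rightarrow> complex) \<Rightarrow> complex) \<Rightarrow> ((complex \<Rightarrow> complex) \<Rightarrow> complex) \<Rightarrow> complex \<Rightarrow> complex" where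
  "transform_weight \<Gamma> \<zz> k \<mu> \<alpha> z = of_real (sqrt 2) * A_fun \<Gamma> \<zz> k \<mu> \<alpha> z / (1 - \<i> * \<zz> z)"

text \<open>
  At a zero of \<open>A\<close> the quotient \<open>k\<^sup>\<alpha>\<^sup>\<mu>(z, 0) / b(z)\<close> equals \<open>-i k\<^sup>\<alpha>(z, 0)\<close>, and the kernel formula on
  the diagonal becomes \<open>k\<^sup>\<alpha>(z, z) = -c \<bar>k\<^sup>\<alpha>(z, 0)\<bar>\<^sup>2 / Im \<zz>(z) \<le> 0\<close>.
\<close>
lemma A_fun_nonzero:
  assumes form: "kernel_formula \<Gamma> \<zz> k \<mu> \<alpha>" and z: "z \<in> Omega_plus \<zz>"
    and kz: "k \<alpha> z z \<noteq> 0" "0 \<le> Re (k \<alpha> z z)" "Im (k \<alpha> z z) = 0" and c: "c_const \<Gamma> \<zz> k \<mu> \<alpha> > 0"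
  shows "A_fun \<Gamma> \<zz> k \<mu> \<alpha> z \<noteq> 0"
proof
  assume "A_fun \<Gamma> \<zz> k \<mu> \<alpha> z = 0"
  then have Q: "kernel_quotient \<Gamma> k \<mu> \<alpha> z = - \<i> * k \<alpha> z 0"
    using c by (simp add: A_fun_def add_eq_0_iff)
  let ?y = "Im (\<zz> z)" and ?n = "(cmod (k \<alpha> z 0))\<^sup>2"
  have y: "?y > 0" and zd: "z \<in> unit_disc" "\<not> is_pole \<zz> z" using z by (auto simp: Omega_plus_def)
  have diff: "\<zz> z - cnj (\<zz> z) = 2 * \<i> * of_real ?y" by (simp add: complex_eq_iff)
  have ne: "\<zz> z \<noteq> cnj (\<zz> z)" using y by (auto simp: complex_eq_iff)
  have "kernel_quotient \<Gamma> k \<mu> \<alpha> z * cnj (k \<alpha> z 0) - cnj (kernel_quotient \<Gamma> k \<mu> \<alpha> z) * k \<alpha> z 0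
      = - 2 * \<i> * of_real ?n"
    unfolding Q complex_norm_square by (simp add: algebra_simps)
  with kernel_formulaD[OF form zd(1,1,2,2) ne]
  have "k \<alpha> z z = of_real (c_const \<Gamma> \<zz> k \<mu> \<alpha>) * ((- 2 * \<i> * of_real ?n) / (2 * \<i> * of_real ?y))"
    by (simp only: diff)
  also have "\<dots> = of_real (- (c_const \<Gamma> \<zz> k \<mu> \<alpha> * ?n / ?y))"
    using y by (simp add: field_simps)
  finally have "Re (k \<alpha> z z) = - (c_const \<Gamma> \<zz> k \<mu> \<alpha> * ?n / ?y)" by (simp only: Re_complex_of_real)
  moreover have "0 \<le> c_const \<Gamma> \<zz> k \<mu> \<alpha> * ?n / ?y" using c y by simp
  ultimately have "Re (k \<alpha> z z) = 0" using kz(2) by linarith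
  then show False using kz(1,3) by (simp add: complex_eq_iff)
qed

text \<open>
  This is where the Schur function enters: as \<open>S \<circ> \<sigma> = B / A\<close>, the kernel of \<open>\<H>(S)\<close> at \<open>\<sigma> z\<close>,
  \<open>\<sigma> w\<close> is a rational expression in the data of the kernel formula.
\<close>
lemma kernel_factorization:
  assumes form: "kernel_formula \<Gamma> \<zz> k \<mu> \<alpha>" and c: "c_const \<Gamma> \<zz> k \<mu> \<alpha> > 0"
    and z: "z \<in> Omega_plus \<zz>" and w: "w \<in> Omega_plus \<zz>"
    and nz: "A_fun \<Gamma> \<zz> k \<mu> \<alpha> z \<noteq> 0" "A_fun \<Gamma> \<zz> k \<mu> \<alpha> w \<noteq> 0"
    and S: "B_fun \<Gamma> \<zz> k \<mu> \<alpha> z / A_fun \<Gamma> \<zz> k \<mu> \<alpha> z = S (cayley_zz \<zz> z)"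
      "B_fun \<Gamma> \<zz> k \<mu> \<alpha> w / A_fun \<Gamma> \<zz> k \<mu> \<alpha> w = S (cayley_zz \<zz> w)"
  shows "transform_weight \<Gamma> \<zz> k \<mu> \<alpha> z * dBR_kernel S (cayley_zz \<zz> z) (cayley_zz \<zz> w)
      * cnj (transform_weight \<Gamma> \<zz> k \<mu> \<alpha> w) = k \<alpha> z w"
proof -
  let ?A = "A_fun \<Gamma> \<zz> k \<mu> \<alpha>" and ?B = "B_fun \<Gamma> \<zz> k \<mu> \<alpha>" and ?Q = "kernel_quotient \<Gamma> k \<mu> \<alpha>"
  let ?c = "c_const \<Gamma> \<zz> k \<mu> \<alpha>"
  define s :: complex where "s = of_real (sqrt (?c / 2))"
  have im: "Im (\<zz> z) > 0" "Im (\<zz> w) > 0" using z w by (auto simp: Omega_plus_def)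
  then have ne: "\<zz> z \<noteq> cnj (\<zz> w)" by (auto simp: complex_eq_iff)
  have "1 + \<i> * cnj (\<zz> w) = cnj (1 - \<i> * \<zz> w)" by simp
  then have m: "1 + \<i> * cnj (\<zz> w) \<noteq> 0"
    using cayley_denominator_nonzero[OF im(2)] by (simp only: complex_cnj_zero_iff) simp
  have nzw: "cnj (?A w) \<noteq> 0" using nz(2) by simp
  have s2: "2 * s\<^sup>2 = of_real ?c"
    using c by (simp add: s_def flip: of_real_power)
  have t: "of_real (sqrt 2) * of_real (sqrt 2) = (2 :: complex)"
    by (simp flip: of_real_mult)
  have "transform_weight \<Gamma> \<zz> k \<mu> \<alpha> z * dBR_kernel S (cayley_zz \<zz> z) (cayley_zz \<zz> w)
      * cnj (transform_weight \<Gamma> \<zz> k \<mu> \<alpha> w)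
    = (of_real (sqrt 2) * ?A z / (1 - \<i> * \<zz> z)) * ((1 - (?B z / ?A z) * (cnj (?B w) / cnj (?A w))) /
      (1 - ((1 + \<i> * \<zz> z) / (1 - \<i> * \<zz> z)) * ((1 - \<i> * cnj (\<zz> w)) / (1 + \<i> * cnj (\<zz> w)))))
      * (of_real (sqrt 2) * cnj (?A w) / (1 + \<i> * cnj (\<zz> w)))"
    unfolding dBR_kernel_def S[symmetric] unfolding transform_weight_def cayley_zz_def by simp
  also have "\<dots> = 2 * s\<^sup>2 * ((?Q z * cnj (k \<alpha> w 0) - cnj (?Q w) * k \<alpha> z 0) / (\<zz> z - cnj (\<zz> w)))"
    by (rule kernel_factorization_identity[OF _ _ _ _ nz(1) nzw cayley_denominator_nonzero[OF im(1)] m ne t])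
      (simp_all add: A_fun_def B_fun_def s_def)
  also have "\<dots> = k \<alpha> z w"
    unfolding s2 by (rule kernel_formulaD[OF form, symmetric]) (use z w ne in \<open>simp_all add: Omega_plus_def\<close>)
  finally show ?thesis .
qed

theorem theorem3p2:
  fixes \<Gamma> :: "(complex \<Rightarrow> complex) set"
    and E :: "complex set"
    and \<zz> :: "complex \<Rightarrow> complex"
    and \<mu> \<alpha> :: "(complex \<Rightarrow> complex) \<Rightarrow> complex"
    and k :: char_kernel
    and \<S> :: "complex \<Rightarrow> complex"
    and H :: "(complex \<Rightarrow> complex) set"
    and ip :: "(complex \<Rightarrow> complex) \<Rightarrow> (complex \<Rightarrow> complex) \<Rightarrow> complex"
  assumes fuchsian: "fuchsian_group \<Gamma>"
    and convergence: "convergence_type \<Gamma>"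
    and no_elliptic: "\<And>\<gamma>. \<gamma> \<in> \<Gamma> \<Longrightarrow> \<not> elliptic \<gamma>"
    and no_parabolic: "\<And>\<gamma>. \<gamma> \<in> \<Gamma> \<Longrightarrow> \<not> parabolic \<gamma>"
    and widom: "widom_type \<Gamma>"
    and mu_character: "unimodular_character \<Gamma> \<mu>"
    and mu: "\<And>\<gamma> z. \<gamma> \<in> \<Gamma> \<Longrightarrow> z \<in> unit_disc \<Longrightarrow> green \<Gamma> (\<gamma> z) = \<mu> \<gamma> * green \<Gamma> z"
    and covering: "universal_covering_map \<Gamma> E \<zz>"
    and normalized: "Im (zb0 \<Gamma> \<zz>) = 0" "Re (zb0 \<Gamma> \<zz>) > 0"
    and kernel: "\<And>\<beta>. unimodular_character \<Gamma> \<beta> \<Longrightarrow>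
        has_reproducing_kernel unit_disc (character_hardy2 \<Gamma> \<beta>) hardy2_inner (k \<beta>)"
    and kernel_pos: "\<And>\<beta> \<xi>. unimodular_character \<Gamma> \<beta> \<Longrightarrow> \<xi> \<in> unit_disc \<Longrightarrow>
        Im (k \<beta> \<xi> \<xi>) = 0 \<and> Re (k \<beta> \<xi> \<xi>) > 0"
    and kernel_form: "\<And>\<beta>. unimodular_character \<Gamma> \<beta> \<Longrightarrow> kernel_formula \<Gamma> \<zz> k \<mu> \<beta>"
    and alpha: "unimodular_character \<Gamma> \<alpha>"
    and schur: "schur_function \<S>"
    and S_alpha: "\<And>z. z \<in> Omega_plus \<zz> \<Longrightarrow>
        B_fun \<Gamma> \<zz> k \<mu> \<alpha> z / A_fun \<Gamma> \<zz> k \<mu> \<alpha> z = \<S> (cayley_zz \<zz> z)"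
    and dBR: "de_Branges_Rovnyak \<S> H ip"
  shows "(\<forall>f\<in>H. \<exists>F. extends_transform \<Gamma> \<zz> k \<mu> \<alpha> f F) \<and>
    (\<forall>f\<in>H. \<forall>F G. extends_transform \<Gamma> \<zz> k \<mu> \<alpha> f F \<and> extends_transform \<Gamma> \<zz> k \<mu> \<alpha> f G \<longrightarrow>
       (\<forall>z\<in>unit_disc. F z = G z)) \<and>
    character_hardy2 \<Gamma> \<alpha> = {F. \<exists>f\<in>H. extends_transform \<Gamma> \<zz> k \<mu> \<alpha> f F} \<and>
    (\<forall>f\<in>H. \<forall>F. extends_transform \<Gamma> \<zz> k \<mu> \<alpha> f F \<longrightarrow> hardy2_norm F = ip_norm ip f)"
proof -
  let ?V = "character_hardy2 \<Gamma> \<alpha>" and ?\<Omega> = "Omega_plus \<zz>" and ?\<sigma> = "cayley_zz \<zz>"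
  let ?g = "transform_weight \<Gamma> \<zz> k \<mu> \<alpha>" and ?K = "dBR_kernel \<S>"
  let ?ext = "extends_transform \<Gamma> \<zz> k \<mu> \<alpha>"
  have alpha_mu: "unimodular_character \<Gamma> (\<lambda>\<gamma>. \<alpha> \<gamma> * \<mu> \<gamma>)"
    using alpha mu_character by (auto simp: unimodular_character_def norm_mult)
  have c: "c_const \<Gamma> \<zz> k \<mu> \<alpha> > 0"
    using kernel_pos[OF alpha_mu, of 0] normalized by (simp add: c_const_def)
  note form = kernel_form[OF alpha]
  have k_nz: "k \<alpha> z z \<noteq> 0" if "z \<in> unit_disc" for z
    using kernel_pos[OF alpha that] by auto
  have ne: "?\<Omega> \<noteq> {}"
    using Omega_plus_nonempty[OF covering fuchsian form, OF k_nz[of 0]] by simp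
  have disc: "y \<in> unit_disc" if "y \<in> ?\<Omega>" for y using that by (simp add: Omega_plus_def)
  have sigma: "?\<sigma> y \<in> unit_disc" if "y \<in> ?\<Omega>" for y
    using cayley_in_disc[of "\<zz> y"] that by (simp add: Omega_plus_def cayley_zz_def)
  have A: "A_fun \<Gamma> \<zz> k \<mu> \<alpha> y \<noteq> 0" if "y \<in> ?\<Omega>" for y
    using A_fun_nonzero[OF form that, OF k_nz[OF disc[OF that]] _ _ c] kernel_pos[OF alpha disc[OF that]]
    by simp
  have g: "?g y \<noteq> 0" if "y \<in> ?\<Omega>" for y
    using A[OF that] cayley_denominator_nonzero[of "\<zz> y"] that
    by (simp add: transform_weight_def Omega_plus_def)
  have kernel_eq: "?g z * ?K (?\<sigma> z) (?\<sigma> w) * cnj (?g w) = k \<alpha> z w" if "z \<in> ?\<Omega>" "w \<in> ?\<Omega>" for z w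
    by (rule kernel_factorization[OF form, OF c that A[OF that(1)] A[OF that(2)]
          S_alpha[OF that(1)] S_alpha[OF that(2)]])
  have H: "hilbert_function_space unit_disc H ip"
    and H_kernel: "\<And>\<nu>. \<nu> \<in> unit_disc \<Longrightarrow> (\<lambda>x. ?K x \<nu>) \<in> H"
      "\<And>\<nu> f. \<nu> \<in> unit_disc \<Longrightarrow> f \<in> H \<Longrightarrow> ip f (\<lambda>x. ?K x \<nu>) = f \<nu>"
    and H_hol: "\<And>f. f \<in> H \<Longrightarrow> f holomorphic_on unit_disc"
    using dBR by (auto simp: de_Branges_Rovnyak_def has_reproducing_kernel_def)
  have V: "hilbert_function_space unit_disc ?V hardy2_inner"
    by (rule character_hardy2_hilbert) (rule fuchsian_group_maps_disc[OF fuchsian])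
  have V_kernel: "\<And>\<nu>. \<nu> \<in> unit_disc \<Longrightarrow> (\<lambda>x. k \<alpha> x \<nu>) \<in> ?V"
      "\<And>\<nu> F. \<nu> \<in> unit_disc \<Longrightarrow> F \<in> ?V \<Longrightarrow> hardy2_inner F (\<lambda>x. k \<alpha> x \<nu>) = F \<nu>"
    using kernel[OF alpha] by (auto simp: has_reproducing_kernel_def)
  have V_hardy: "F \<in> hardy2" "F holomorphic_on unit_disc" if "F \<in> ?V" for F
    using that by (auto simp: character_hardy2_def hardy2_def)
  interpret L: hilbert_functions unit_disc H ip by standard (rule H)
  let ?u = "\<lambda>y x. cnj (?g y) * ?K x (?\<sigma> y)" and ?v = "\<lambda>y x. k \<alpha> x y"
  have u: "?u y \<in> H" if "y \<in> ?\<Omega>" for y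
    by (rule L.scale_mem[OF H_kernel(1)[OF sigma[OF that]]])
  have ip_u: "ip f (?u y) = ?g y * f (?\<sigma> y)" if "y \<in> ?\<Omega>" "f \<in> H" for y f
    using L.ip_scale_right[OF H_kernel(1)[OF sigma[OF that(1)]] that(2)]
    by (simp add: H_kernel(2)[OF sigma[OF that(1)] that(2)])
  have v: "?v y \<in> ?V" if "y \<in> ?\<Omega>" for y using V_kernel(1)[OF disc[OF that]] .
  have ip_v: "hardy2_inner F (?v y) = F y" if "y \<in> ?\<Omega>" "F \<in> ?V" for y F
    using V_kernel(2)[OF disc[OF that(1)] that(2)] .
  have gram: "ip (?u y) (?u z) = hardy2_inner (?v y) (?v z)" if "y \<in> ?\<Omega>" "z \<in> ?\<Omega>" for y z
    unfolding ip_u[OF that(2) u[OF that(1)]] ip_v[OF that(2) v[OF that(1)]]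
      kernel_eq[OF that(2,1), symmetric] by (simp only: mult_ac)
  have ext_iff: "?ext f F \<longleftrightarrow> F holomorphic_on unit_disc \<and> (\<forall>y\<in>?\<Omega>. F y = ?g y * f (?\<sigma> y))" for f F
    by (simp add: extends_transform_def transform_weight_def)
  have unique: "F z = G z" if "?ext f F" "?ext f G" "z \<in> unit_disc" for f F G z
    using Omega_plus_uniqueness[OF covering ne, of F G z] that by (simp add: ext_iff)
  have forward: "\<exists>F\<in>?V. ?ext f F \<and> hardy2_norm F = ip_norm ip f" if f: "f \<in> H" for f
  proof -
    have "\<exists>F\<in>?V. (\<forall>y\<in>?\<Omega>. hardy2_inner F (?v y) = ip f (?u y)) \<and>
        ip_norm hardy2_inner F = ip_norm ip f"
    proof (rule equal_gram_isometry[where Y = ?\<Omega> and u = ?u and v = ?v, OF H V])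
      fix h x assume h: "h \<in> H" and x: "x \<in> unit_disc"
        and orth: "\<And>y. y \<in> ?\<Omega> \<Longrightarrow> ip h (?u y) = 0"
      show "h x = 0"
      proof (rule cayley_image_uniqueness[OF covering ne H_hol[OF h] _ x])
        show "h (?\<sigma> y) = 0" if y: "y \<in> ?\<Omega>" for y
          using orth[OF y] g[OF y] by (simp add: ip_u[OF y h])
      qed
    qed (fact u v gram f)+
    then obtain F where F: "F \<in> ?V" "\<forall>y\<in>?\<Omega>. hardy2_inner F (?v y) = ip f (?u y)"
      "ip_norm hardy2_inner F = ip_norm ip f" by blast
    have "?ext f F"
      unfolding ext_iff using F V_hardy(2)[OF F(1)] ip_u[OF _ f] ip_v[OF _ F(1)] by simp
    then show ?thesis using F V_hardy(1)[OF F(1)] by (auto simp: hardy2_ip_norm)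
  qed
  have backward: "\<exists>f\<in>H. ?ext f F" if F: "F \<in> ?V" for F
  proof -
    have "\<exists>f\<in>H. (\<forall>y\<in>?\<Omega>. ip f (?u y) = hardy2_inner F (?v y)) \<and>
        ip_norm ip f = ip_norm hardy2_inner F"
    proof (rule equal_gram_isometry[where Y = ?\<Omega> and u = ?v and v = ?u, OF V H])
      fix h x assume h: "h \<in> ?V" and x: "x \<in> unit_disc"
        and orth: "\<And>y. y \<in> ?\<Omega> \<Longrightarrow> hardy2_inner h (?v y) = 0"
      show "h x = 0"
        using Omega_plus_uniqueness[OF covering ne V_hardy(2)[OF h] holomorphic_on_const, of 0 x]
          x orth ip_v[OF _ h] by simp
    qed (fact u v gram[symmetric] F)+
    then obtain f where f: "f \<in> H" "\<forall>y\<in>?\<Omega>. ip f (?u y) = hardy2_inner F (?v y)" by blast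
    have "?ext f F"
      unfolding ext_iff using f(2) V_hardy(2)[OF F] ip_u[OF _ f(1)] ip_v[OF _ F] by simp
    then show ?thesis using f(1) by blast
  qed
  have ext: "F \<in> ?V \<and> hardy2_norm F = ip_norm ip f" if f: "f \<in> H" and F: "?ext f F" for f F
  proof -
    obtain G where G: "G \<in> ?V" "?ext f G" "hardy2_norm G = ip_norm ip f" using forward[OF f] by blast
    have hol: "F holomorphic_on unit_disc" using F by (simp add: ext_iff)
    have eq: "G z = F z" if "z \<in> unit_disc" for z using unique[OF G(2) F that] .
    show ?thesis
      using character_hardy2_cong[where F = G and G = F, OF fuchsian G(1) hol eq] G(3) by simp
  qed
  show ?thesis
  proof (intro conjI)
    show "\<forall>f\<in>H. \<exists>F. ?ext f F" using forward by blast
    show "\<forall>f\<in>H. \<forall>F G. ?ext f F \<and> ?ext f G \<longrightarrow> (\<forall>z\<in>unit_disc. F z = G z)"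
      using unique by blast
    show "?V = {F. \<exists>f\<in>H. ?ext f F}" using ext backward by blast
    show "\<forall>f\<in>H. \<forall>F. ?ext f F \<longrightarrow> hardy2_norm F = ip_norm ip f" using ext by blast
  qed
qed

end
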